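(* Let $\mathbb{X}$ be a Banach space with a quasi-greedy basis. If $B_{1,0}=(\bigoplus_{n=1}^\infty\ell_1^n)_0$ is isomorphic to a complemented subspace of $\mathbb{X}$, then there is a quasi-greedy basis $\mathcal{B}$ for $\mathbb{X}$ with $L_m[\mathcal{B}]\approx\log m$ for $m\ge2$.
   Context: Banach spaces are real or complex and bases are Schauder bases. Let $\mathcal{B}=(\mathbf{x}_n)_{n=1}^\infty$ be a basis of $\mathbb{X}$ with coordinate functionals $(\mathbf{x}_n^* )_{n=1}^\infty$. For $A\subseteq\mathbb{N}$, the coordinate projection is $S_A[\mathcal{B}](f)=\sum_{n\in A}\mathbf{x}_n^*(f)\,\mathbf{x}_n$ (when well defined), and $\operatorname{supp}(f)=\{n:\mathbf{x}_n^*(f)\neq0\}$. The basis is quasi-greedy if $0<\inf_j\|\mathbf{x}_j\|\le\sup_j\|\mathbf{x}_j\|<\infty$ and there is a constant $C$ such that $\|f-S_A[\mathcal{B}](f)\|\le C\|f\|$ whenever $f\in\mathbb{X}$ and $A\subseteq\mathbb{N}$ satisfy $|\mathbf{x}_j^*(f)|\le|\mathbf{x}_k^*(f)|$ for all $j\in\mathbb{N}\setminus A$ and $k\in A$. The w-conditionality constants are $$L_m[\mathcal{B}]=\sup\left\{\frac{\|S_A[\mathcal{B}](f)\|}{\|f\|}: f\ne0,\ \max(\operatorname{supp}(f))\le m,\ A\subseteq\mathbb{N}\right\}.$$ $\ell_1^n$ is $\mathbb{F}^n$ ($\mathbb{F}$ the scalar field) with the $\ell_1$-norm, and $(\bigoplus_{n}\mathbb{X}_n)_0$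 is the direct sum in the $c_0$-sense. For families of nonnegative reals, $\alpha_i\lesssim\beta_i$ means there is a constant $C$ with $\alpha_i\le C\beta_i$ for all $i$, and $\alpha_i\approx\beta_i$ means $\alpha_i\lesssim\beta_i$ and $\beta_i\lesssim\alpha_i$. *)

theory Defs
  imports "HOL-Analysis.Analysis"
begin

(* A Banach space over the scalar field 'f.  The type class banach only provides multiplication
   by real scalars, so the multiplication by scalars in 'f is an explicit parameter that extends
   it.  The types real and complex belong to the sort {real_normed_field, euclidean_space} and,
   up to isometric isomorphism, they are its only members (a finite-dimensional commutative real
   division algebra with multiplicative norm), so the real and the complex case are both covered
   and nothing else is. *)
locale banach_over = vector_space smul
  for smul :: "'f::{real_normed_field,euclidean_space} \<Rightarrow> 'x::banach \<Rightarrow> 'x" +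
  assumes norm_smul: "norm (smul c x) = norm c * norm x"
    and smul_of_real: "smul (of_real r) x = r *\<^sub>R x"

(* All sequences are indexed from 0: the entry at j : nat is the one the mathematical notation
   numbers j + 1. *)

definition schauder_basis :: "('f::real_normed_field \<Rightarrow> 'x::banach \<Rightarrow> 'x) \<Rightarrow> (nat \<Rightarrow> 'x) \<Rightarrow> bool" where
  "schauder_basis smul B \<longleftrightarrow> (\<forall>f. \<exists>!a. (\<lambda>n. smul (a n) (B n)) sums f)"

definition coord :: "('f::real_normed_field \<Rightarrow> 'x::banach \<Rightarrow> 'x) \<Rightarrow> (nat \<Rightarrow> 'x) \<Rightarrow> nat \<Rightarrow> 'x \<Rightarrow> 'f" where
  "coord smul B n f = (THE a. (\<lambda>k. smul (a k) (B k)) sums f) n"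

definition supp :: "('f::real_normed_field \<Rightarrow> 'x::banach \<Rightarrow> 'x) \<Rightarrow> (nat \<Rightarrow> 'x) \<Rightarrow> 'x \<Rightarrow> nat set" where
  "supp smul B f = {n. coord smul B n f \<noteq> 0}"

(* Meaningful when the series converges.  This is so for all A below: in L_const the series is a
   finite sum, and in quasi_greedy_basis either A is finite or, the coordinates of f being a null
   sequence, A contains the support of f. *)
definition coord_proj ::
  "('f::real_normed_field \<Rightarrow> 'x::banach \<Rightarrow> 'x) \<Rightarrow> (nat \<Rightarrow> 'x) \<Rightarrow> nat set \<Rightarrow> 'x \<Rightarrow> 'x" where
  "coord_proj smul B A f = (\<Sum>n. if n \<in> A then smul (coord smul B n f) (B n) else 0)"

definition quasi_greedy_basis ::
  "('f::real_normed_field \<Rightarrow> 'x::banach \<Rightarrow> 'x) \<Rightarrow> (nat \<Rightarrow> 'x) \<Rightarrow> bool" where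
  "quasi_greedy_basis smul B \<longleftrightarrow>
     schauder_basis smul B \<and>
     0 < (INF j. norm (B j)) \<and> bdd_above (range (\<lambda>j. norm (B j))) \<and>
     (\<exists>C. \<forall>f A. (\<forall>j k. j \<notin> A \<longrightarrow> k \<in> A \<longrightarrow> norm (coord smul B j f) \<le> norm (coord smul B k f))
            \<longrightarrow> norm (f - coord_proj smul B A f) \<le> C * norm f)"

(* Because of the indexing from 0, max (supp f) \<le> m reads supp f \<subseteq> {..<m}.  For a
   Schauder basis and m \<ge> 1 the supremum is over a nonempty bounded set. *)
definition L_const ::
  "('f::real_normed_field \<Rightarrow> 'x::banach \<Rightarrow> 'x) \<Rightarrow> (nat \<Rightarrow> 'x) \<Rightarrow> nat \<Rightarrow> real" where
  "L_const smul B m =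
     Sup {norm (coord_proj smul B A f) / norm f | f A. f \<noteq> 0 \<and> supp smul B f \<subseteq> {..<m}}"

definition l1_carrier :: "nat \<Rightarrow> (nat \<Rightarrow> 'f::real_normed_field) set" where
  "l1_carrier n = {a. \<forall>i\<ge>n. a i = 0}"

definition l1_norm :: "nat \<Rightarrow> (nat \<Rightarrow> 'f::real_normed_field) \<Rightarrow> real" where
  "l1_norm n a = (\<Sum>i<n. norm (a i))"

(* The sum of the spaces l1^1, l1^2, ... in the c0 sense; the component u n lies in l1^(n+1). *)
definition B10_carrier :: "(nat \<Rightarrow> nat \<Rightarrow> 'f::real_normed_field) set" where
  "B10_carrier =
     {u. (\<forall>n. u n \<in> l1_carrier (Suc n)) \<and> (\<lambda>n. l1_norm (Suc n) (u n)) \<longlonglongrightarrow> 0}"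

definition B10_norm :: "(nat \<Rightarrow> nat \<Rightarrow> 'f::real_normed_field) \<Rightarrow> real" where
  "B10_norm u = (SUP n. l1_norm (Suc n) (u n))"

definition complemented_subspace ::
  "('f::real_normed_field \<Rightarrow> 'x::banach \<Rightarrow> 'x) \<Rightarrow> 'x set \<Rightarrow> bool" where
  "complemented_subspace smul Y \<longleftrightarrow>
     (\<exists>P. Vector_Spaces.linear smul smul P \<and> (\<exists>K. \<forall>x. norm (P x) \<le> K * norm x) \<and>
          (\<forall>x. P (P x) = P x) \<and> range P = Y)"

definition B10_isomorphic_to ::
  "('f::real_normed_field \<Rightarrow> 'x::banach \<Rightarrow> 'x) \<Rightarrow> 'x set \<Rightarrow> bool" where
  "B10_isomorphic_to smul Y \<longleftrightarrow>
     (\<exists>T :: (nat \<Rightarrow> nat \<Rightarrow> 'f) \<Rightarrow> 'x.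
        bij_betw T B10_carrier Y \<and>
        (\<forall>u\<in>B10_carrier. \<forall>v\<in>B10_carrier. T (\<lambda>n i. u n i + v n i) = T u + T v) \<and>
        (\<forall>c. \<forall>u\<in>B10_carrier. T (\<lambda>n i. c * u n i) = smul c (T u)) \<and>
        (\<exists>c>0. \<exists>K. \<forall>u\<in>B10_carrier. c * B10_norm u \<le> norm (T u) \<and> norm (T u) \<le> K * B10_norm u))"

definition lesssim_on :: "'i set \<Rightarrow> ('i \<Rightarrow> real) \<Rightarrow> ('i \<Rightarrow> real) \<Rightarrow> bool" where
  "lesssim_on I \<alpha> \<beta> \<longleftrightarrow> (\<exists>C. \<forall>i\<in>I. \<alpha> i \<le> C * \<beta> i)"

definition approx_on :: "'i set \<Rightarrow> ('i \<Rightarrow> real) \<Rightarrow> ('i \<Rightarrow> real) \<Rightarrow> bool" where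
  "approx_on I \<alpha> \<beta> \<longleftrightarrow> lesssim_on I \<alpha> \<beta> \<and> lesssim_on I \<beta> \<alpha>"

end

theory Submission
  imports Defs
begin

text \<open>Since the \<open>c\<^sub>0\<close>-sum of the \<open>\<ell>\<^sub>1\<^sup>n\<close> contains infinitely
  many complemented copies of itself, a Hilbert hotel argument splits off one of them: the space is isomorphic to
  its direct sum with \<open>B10_carrier\<close>. The given basis of the first summand is interleaved with a basis
  of the second one that consists of Lindenstrauss-type bases of the blocks, and both summands of a greedy sum are
  again greedy sums. In a block the basis vectors are \<open>e\<^sub>i - (e\<^bsub>2i+1\<^esub> +
  e\<^bsub>2i+2\<^esub>) / 2\<close>, indexed by the nodes of a binary tree (entries outside of the block are
  dropped); a vector with basis coefficients \<open>z\<close> has the entries \<open>z\<^sub>i - z\<^sub>p /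
  2\<close>, where \<open>p\<close> is the parent of \<open>i\<close>. The weak-type estimate \<open>t * card {i. t
  \<le> \<bar>z\<^sub>i\<bar>} \<le> 2 * norm\<close> makes these bases uniformly quasi-greedy, while
  \<open>z\<^sub>i = 1 / (i + 1)\<close> shows that coordinate projections of vectors supported in the first
  \<open>m\<close> coordinates can have norm of order \<open>ln m\<close>. Conversely, any quasi-greedy basis
  satisfies a logarithmic upper bound, because coordinate projections are bounded on vectors whose nonzero
  coefficients have comparable modulus, and only about \<open>ln m\<close> dyadic levels of coefficients
  matter.\<close>

text \<open>The given basis belongs to the whole space, while no basis is known for the complement
  of the copy of \<open>B10_carrier\<close>. Hence a further copy has to be absorbed instead of
  exchanging the basis on the existing one. The given basis may itself be conditional: the upper
  bound holds for every quasi-greedy basis, so only the lower bound has to be built in.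

  The weight 1/2 is matched to the two children of a node. What a coefficient hands down to the next
  generation has in total no more than its own modulus, so mass is never created on the way down.
  The estimates for greedy and for initial projections rest on this balance, with constants
  independent of the block length, as a supremum over all blocks demands.

  \<open>L_const\<close> is measured against positions in the basis, not against dimensions. Listed
  one after the other and interleaved, a block of length \<open>n\<close> ends at a position of
  order \<open>n^2\<close>; the logarithm turns this loss into a factor 2.\<close>

section \<open>Weighted binary trees and their l1 inequalities\<close>

fun tree_diff :: "(nat \<Rightarrow> 'f::real_normed_field) \<Rightarrow> nat \<Rightarrow> 'f" where
  "tree_diff z 0 = z 0"
| "tree_diff z (Suc i) = z (Suc i) - z (i div 2) / 2"

text \<open>Unrolled, this adds the values of \<open>v\<close> on the path from \<open>i\<close> up
  to the root, with weight \<open>2^-d\<close> at distance \<open>d\<close>. It inverts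
  \<open>tree_diff\<close>, and the geometric series of the weights gives the factor 2 in
  \<open>norm_tree_sum_le\<close>.\<close>

fun tree_sum :: "(nat \<Rightarrow> 'f::real_normed_field) \<Rightarrow> nat \<Rightarrow> 'f" where
  "tree_sum v 0 = v 0"
| "tree_sum v (Suc i) = v (Suc i) + tree_sum v (i div 2) / 2"

lemma tree_diff_tree_sum [simp]: "tree_diff (tree_sum v) i = v i"
  by (cases i) simp_all

text \<open>Parents precede their children, so the recursion never leaves the indices up to
  \<open>i\<close>. The hypothesis stops there because an element of a block agrees with
  \<open>tree_diff z\<close> only inside the block, its entries being cut off beyond.\<close>

lemma tree_sum_tree_diff: "(\<And>j. j \<le> i \<Longrightarrow> v j = tree_diff z j) \<Longrightarrow> tree_sum v i = z i"
proof (induction i rule: less_induct)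
  case (less i)
  show ?case
  proof (cases i)
    case 0
    then show ?thesis using less.prems[of 0] by simp
  next
    case (Suc j)
    have "tree_sum v (j div 2) = z (j div 2)"
    proof (rule less.IH)
      show "j div 2 < i" using Suc by simp
      show "v l = tree_diff z l" if "l \<le> j div 2" for l
        using that Suc by (intro less.prems) linarith
    qed
    then show ?thesis using less.prems[of i] Suc by simp
  qed
qed

lemma tree_diff_cong: "(\<And>j. j \<le> i \<Longrightarrow> z j = z' j) \<Longrightarrow> tree_diff z i = tree_diff z' i"
proof (cases i)
  case (Suc j)
  assume eq: "\<And>j. j \<le> i \<Longrightarrow> z j = z' j"
  have "z (j div 2) = z' (j div 2)" using Suc by (intro eq) simp
  then show ?thesis using Suc eq[of i] by simp
qed simp

lemma norm_tree_sum_le: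
  assumes "\<And>j. norm (v j) \<le> M"
  shows "norm (tree_sum v i) \<le> 2 * M"
proof (induction i rule: less_induct)
  case (less i)
  have M: "0 \<le> M" using order_trans[OF norm_ge_zero assms[of 0]] .
  show ?case
  proof (cases i)
    case 0
    then show ?thesis using assms[of 0] M by simp
  next
    case (Suc j)
    have "norm (tree_sum v (j div 2)) \<le> 2 * M" using Suc by (intro less.IH) simp
    then have "norm (tree_sum v (j div 2) / 2) \<le> M" by (simp add: norm_divide)
    then show ?thesis
      using norm_triangle_ineq[of "v i" "tree_sum v (j div 2) / 2"] assms[of i] Suc by simp
  qed
qed

text \<open>Each \<open>j\<close> equals \<open>i div 2\<close> for exactly two \<open>i\<close>,
  whose successors are the children of \<open>j\<close>. The resulting 2 cancels against the weight
  1/2 on the edges.\<close>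

lemma sum_div2_le:
  fixes g :: "nat \<Rightarrow> real"
  assumes "\<And>j. 0 \<le> g j"
  shows "(\<Sum>i<n. g (i div 2)) \<le> 2 * (\<Sum>j<n. g j)"
proof -
  have eq: "(\<Sum>i<2*m. g (i div 2)) = 2 * (\<Sum>j<m. g j)" for m
    by (induction m) simp_all
  have "(\<Sum>i<n. g (i div 2)) \<le> (\<Sum>i<2*n. g (i div 2))"
    by (rule sum_mono2) (simp_all add: assms)
  then show ?thesis using eq by simp
qed

text \<open>The truncations \<open>F\<close> and \<open>G\<close> in the proof satisfy \<open>F (x / 2) = G x / 2\<close> and \<open>F x - G x \<ge> t / 2\<close> for
  \<open>x \<ge> t\<close>, and a node has at most two children.\<close>

lemma tree_weak_type:
  assumes t: "0 < t"
  shows "t * real (card {i. i < Suc n \<and> t \<le> norm (z i)}) \<le> 2 * (\<Sum>i<Suc n. norm (tree_diff z i))"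
proof -
  define F where "F x = max (x - t/2) 0" for x :: real
  define G where "G x = max (x - t) 0" for x :: real
  have G0: "0 \<le> G x" for x by (simp add: G_def)
  \<comment> \<open>\<open>F\<close> is monotone and 1-Lipschitz, and the subtracted term is
    \<open>F\<close> at half the modulus of the parent's coefficient.\<close>
  have step: "F (norm (z (Suc i))) - G (norm (z (i div 2))) / 2 \<le> norm (tree_diff z (Suc i))" for i
  proof -
    have "norm (z (Suc i)) - norm (z (i div 2) / 2) \<le> norm (z (Suc i) - z (i div 2) / 2)"
      by (rule norm_triangle_ineq2)
    then show ?thesis using norm_ge_zero[of "z (Suc i) - z (i div 2) / 2"]
      by (simp add: F_def G_def norm_divide max_def field_simps split: if_splits)
  qed
  have "(t/2) * real (card {i. i < Suc n \<and> t \<le> norm (z i)})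
      = (\<Sum>i<Suc n. if t \<le> norm (z i) then t/2 else 0)"
  proof -
    have "(\<Sum>i<Suc n. if t \<le> norm (z i) then t/2 else 0) = (\<Sum>i\<in>{i\<in>{..<Suc n}. t \<le> norm (z i)}. t/2)"
      by (rule sum.inter_filter[symmetric]) simp
    then show ?thesis by simp
  qed
  also have "\<dots> \<le> (\<Sum>i<Suc n. F (norm (z i)) - G (norm (z i)))"
    by (rule sum_mono) (use t in \<open>simp add: F_def G_def max_def\<close>)
  also have "\<dots> = (\<Sum>i<Suc n. F (norm (z i))) - (\<Sum>i<Suc n. G (norm (z i)))"
    by (rule sum_subtractf)
  also have "\<dots> \<le> (\<Sum>i<Suc n. F (norm (z i))) - (\<Sum>i<n. G (norm (z (i div 2)))) / 2"
    using sum_div2_le[of "\<lambda>i. G (norm (z i))" n, OF G0] G0[of "norm (z n)"] by simp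
  also have "\<dots> = F (norm (z 0)) + (\<Sum>i<n. F (norm (z (Suc i))) - G (norm (z (i div 2))) / 2)"
    by (simp only: sum.lessThan_Suc_shift sum_subtractf sum_divide_distrib)
  also have "\<dots> \<le> norm (tree_diff z 0) + (\<Sum>i<n. norm (tree_diff z (Suc i)))"
  proof (rule add_mono)
    show "F (norm (z 0)) \<le> norm (tree_diff z 0)" using t by (simp add: F_def)
    show "(\<Sum>i<n. F (norm (z (Suc i))) - G (norm (z (i div 2))) / 2) \<le> (\<Sum>i<n. norm (tree_diff z (Suc i)))"
      by (rule sum_mono) (rule step)
  qed
  also have "\<dots> = (\<Sum>i<Suc n. norm (tree_diff z i))"
    by (simp only: sum.lessThan_Suc_shift)
  finally show ?thesis by (simp add: field_simps)
qed

text \<open>Let \<open>t\<close> be the least modulus on \<open>A\<close>; off \<open>A\<close> the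
  moduli are at most \<open>t\<close>. Deleting \<open>A\<close> can enlarge an entry only where
  exactly one of node and parent is deleted, and what survives there is at most \<open>t / 2\<close>
  (the parent's share) or \<open>t\<close> (the node itself). A deleted node is thus charged
  \<open>t / 2\<close> once and \<open>t\<close> for each of at most two children. By
  \<open>tree_weak_type\<close> the total \<open>5 / 2 * t * card A'\<close> is at most 5 times the
  norm, and the old entries add one more.\<close>

lemma tree_greedy:
  assumes gr: "\<And>j k. j < Suc n \<Longrightarrow> k < Suc n \<Longrightarrow> j \<notin> A \<Longrightarrow> k \<in> A \<Longrightarrow> norm (z j) \<le> norm (z k)"
  shows "(\<Sum>i<Suc n. norm (tree_diff (\<lambda>i. if i \<in> A then 0 else z i) i))
      \<le> 6 * (\<Sum>i<Suc n. norm (tree_diff z i))" (is "?L \<le> 6 * ?N")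
proof -
  define z' where "z' i = (if i \<in> A then 0 else z i)" for i
  define A' where "A' = {i\<in>{..<Suc n}. i \<in> A}"
  have N0: "0 \<le> ?N" by (simp add: sum_nonneg)
  have fin: "finite A'" unfolding A'_def by simp
  show ?thesis
  proof (cases "A' = {}")
    case True
    have "tree_diff z' i = tree_diff z i" if "i < Suc n" for i
      using that True by (intro tree_diff_cong) (simp add: z'_def A'_def)
    then have "?L = ?N" unfolding z'_def by simp
    then show ?thesis using N0 by linarith
  next
    case False
    define t where "t = Min ((\<lambda>i. norm (z i)) ` A')"
    have "t \<in> (\<lambda>i. norm (z i)) ` A'" unfolding t_def using fin False by (intro Min_in) simp_all
    then obtain k where k: "k \<in> A'" "t = norm (z k)" by (rule imageE)
    have off: "norm (z j) \<le> t" if "j < Suc n" "j \<notin> A" for j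
      using gr[of j k] that k by (simp add: A'_def)
    have on: "t \<le> norm (z j)" if "j \<in> A'" for j
      unfolding t_def using fin that by (intro Min_le) simp_all
    have t0: "0 \<le> t" using k by simp
    have pt: "norm (tree_diff z' (Suc i)) \<le> norm (tree_diff z (Suc i))
        + (if Suc i \<in> A then t/2 else 0) + (if i div 2 \<in> A then t else 0)" if i: "i < n" for i
    proof -
      have a: "norm (z (Suc i)) \<le> t" if "Suc i \<notin> A" using off[of "Suc i"] i that by simp
      have b: "norm (z (i div 2) / 2) \<le> t / 2" if "i div 2 \<notin> A"
        using off[of "i div 2"] i that by (simp add: norm_divide)
      have nn: "0 \<le> norm (tree_diff z (Suc i))" by simp
      show ?thesis
      proof (cases "Suc i \<in> A"; cases "i div 2 \<in> A")
        assume "Suc i \<in> A" "i div 2 \<in> A"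
        then show ?thesis using t0 by (simp add: z'_def)
      next
        assume a2: "Suc i \<in> A" "i div 2 \<notin> A"
        then have "norm (tree_diff z' (Suc i)) \<le> t / 2" using b by (simp add: z'_def)
        then have "norm (tree_diff z' (Suc i)) \<le> norm (tree_diff z (Suc i)) + t / 2 + 0" using nn by linarith
        then show ?thesis by (simp only: a2 if_True if_False simp_thms)
      next
        assume a2: "Suc i \<notin> A" "i div 2 \<in> A"
        then have "norm (tree_diff z' (Suc i)) \<le> t" using a by (simp add: z'_def)
        then have "norm (tree_diff z' (Suc i)) \<le> norm (tree_diff z (Suc i)) + 0 + t" using nn by linarith
        then show ?thesis by (simp only: a2 if_True if_False simp_thms)
      next
        assume "Suc i \<notin> A" "i div 2 \<notin> A"
        then show ?thesis by (simp add: z'_def)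
      qed
    qed
    have cardA: "(\<Sum>i<Suc n. if i \<in> A then c else 0) = c * real (card A')" for c :: real
      unfolding A'_def using sum.inter_filter[of "{..<Suc n}" "\<lambda>_. c" "\<lambda>i. i \<in> A"] by (simp add: mult.commute del: sum.lessThan_Suc)
    have wt: "t * real (card A') \<le> 2 * ?N"
    proof (cases "t = 0")
      case False
      have "card A' \<le> card {i. i < Suc n \<and> t \<le> norm (z i)}"
        by (rule card_mono) (use on in \<open>simp_all add: A'_def subset_iff\<close>)
      then have "t * real (card A') \<le> t * real (card {i. i < Suc n \<and> t \<le> norm (z i)})"
        using t0 by (intro mult_left_mono) simp_all
      also have "\<dots> \<le> 2 * ?N" using False t0 by (intro tree_weak_type) simp
      finally show ?thesis .
    qed (use N0 in simp)
    have "?L = norm (z' 0) + (\<Sum>i<n. norm (tree_diff z' (Suc i)))"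
      unfolding z'_def by (subst sum.lessThan_Suc_shift) simp
    \<comment> \<open>The root has no parent that could survive; its \<open>t / 2\<close> is slack
      that completes the sum over all deleted nodes.\<close>
    also have "\<dots> \<le> norm (z 0) + (if 0 \<in> A then t/2 else 0) + (\<Sum>i<n. norm (tree_diff z (Suc i))
        + (if Suc i \<in> A then t/2 else 0) + (if i div 2 \<in> A then t else 0))"
      using t0 by (intro add_mono sum_mono pt) (simp_all add: z'_def)
    also have "\<dots> = ?N + (\<Sum>i<Suc n. if i \<in> A then t/2 else 0) + (\<Sum>i<n. if i div 2 \<in> A then t else 0)"
      unfolding sum.lessThan_Suc_shift by (simp add: sum.distrib)
    also have "(\<Sum>i<n. if i div 2 \<in> A then t else 0) \<le> 2 * (\<Sum>i<n. if i \<in> A then t else 0)"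
      using sum_div2_le[of "\<lambda>i. if i \<in> A then t else 0" n] t0 by simp
    also have "(\<Sum>i<n. if i \<in> A then t else 0) \<le> (\<Sum>i<Suc n. if i \<in> A then t else 0)"
      using t0 by simp
    finally show ?thesis unfolding cardA using wt by linarith
  qed
qed

text \<open>An initial segment contains the parents of its nodes, so the only damage is at dropped
  nodes, which retain half of a kept parent. The estimate \<open>d\<close> takes every kept entry
  twice and spends one copy on \<open>g (Suc i) - g (i div 2) / 2\<close>. Summed up, these
  differences are at least \<open>- g 0\<close>, because the halves handed down do not exceed the
  moduli of the parents.\<close>

lemma tree_partial_sum:
  "(\<Sum>i<Suc n. norm (tree_diff (\<lambda>i. if i < k then z i else 0) i))
      \<le> 2 * (\<Sum>i<Suc n. norm (tree_diff z i))" (is "?L \<le> 2 * ?N")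
proof (cases "k \<le> n")
  case False
  have "tree_diff (\<lambda>i. if i < k then z i else 0) i = tree_diff z i" if "i < Suc n" for i
    using that False by (intro tree_diff_cong) simp
  then have "?L = ?N" by simp
  moreover have "0 \<le> ?N" by (simp add: sum_nonneg)
  ultimately show ?thesis by linarith
next
  case k: True
  define z' where "z' i = (if i < k then z i else 0)" for i
  define g where "g i = norm (z' i)" for i
  have d: "norm (tree_diff z' (Suc i)) \<le> (if Suc i < k then 2 * norm (tree_diff z (Suc i)) else 0)
             + g (i div 2) / 2 - g (Suc i)" for i
  proof (cases "Suc i < k")
    case True
    have "i div 2 < k" using True by linarith
    moreover have "norm (z (Suc i)) - norm (z (i div 2) / 2) \<le> norm (z (Suc i) - z (i div 2) / 2)"
      by (rule norm_triangle_ineq2)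
    moreover have "norm (z (Suc i)) \<le> norm (z (Suc i) - z (i div 2) / 2) + norm (z (i div 2) / 2)"
      using norm_triangle_ineq[of "z (Suc i) - z (i div 2) / 2" "z (i div 2) / 2"] by simp
    ultimately show ?thesis using True by (simp add: z'_def g_def norm_divide)
  next
    case False
    then show ?thesis by (simp add: z'_def g_def norm_divide)
  qed
  have "(\<Sum>i<n. g (i div 2)) / 2 \<le> (\<Sum>i<n. g i)"
    using sum_div2_le[of g n] by (simp add: g_def)
  also have "\<dots> \<le> (\<Sum>i<Suc n. g i)" by (simp add: g_def)
  also have "\<dots> = g 0 + (\<Sum>i<n. g (Suc i))" by (rule sum.lessThan_Suc_shift)
  finally have s: "(\<Sum>i<n. g (i div 2)) / 2 \<le> g 0 + (\<Sum>i<n. g (Suc i))" .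
  have "?L = norm (z' 0) + (\<Sum>i<n. norm (tree_diff z' (Suc i)))"
    unfolding z'_def by (subst sum.lessThan_Suc_shift) simp
  also have "\<dots> \<le> g 0 + (\<Sum>i<n. (if Suc i < k then 2 * norm (tree_diff z (Suc i)) else 0)
             + g (i div 2) / 2 - g (Suc i))"
    by (intro add_mono sum_mono d) (simp add: g_def)
  also have "\<dots> = g 0 + (\<Sum>i<n. if Suc i < k then 2 * norm (tree_diff z (Suc i)) else 0)
             + (\<Sum>i<n. g (i div 2)) / 2 - (\<Sum>i<n. g (Suc i))"
    by (simp add: sum.distrib sum_subtractf sum_divide_distrib)
  also have "\<dots> \<le> 2 * g 0 + (\<Sum>i<n. if Suc i < k then 2 * norm (tree_diff z (Suc i)) else 0)"
    using s by linarith
  also have "\<dots> \<le> 2 * norm (z 0) + (\<Sum>i<n. 2 * norm (tree_diff z (Suc i)))"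
    by (intro add_mono sum_mono) (simp_all add: g_def z'_def)
  also have "\<dots> = 2 * ?N"
    unfolding sum.lessThan_Suc_shift by (simp add: sum_distrib_left)
  finally show ?thesis .
qed

section \<open>The sum of the blocks in the c0 sense\<close>

lemma l1_norm_nonneg: "0 \<le> l1_norm n a"
  by (simp add: l1_norm_def sum_nonneg)

lemma B10_carrierI:
  assumes "\<And>n i. n < i \<Longrightarrow> u n i = 0" "(\<lambda>n. l1_norm (Suc n) (u n)) \<longlonglongrightarrow> 0"
  shows "u \<in> B10_carrier"
  using assms by (simp add: B10_carrier_def l1_carrier_def)

lemma B10_carrier_zero: "u \<in> B10_carrier \<Longrightarrow> n < i \<Longrightarrow> u n i = 0"
  by (simp add: B10_carrier_def l1_carrier_def)

lemma B10_carrier_tendsto: "u \<in> B10_carrier \<Longrightarrow> (\<lambda>n. l1_norm (Suc n) (u n)) \<longlonglongrightarrow> 0"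
  by (simp add: B10_carrier_def)

lemma B10_norm_upper:
  assumes "u \<in> B10_carrier"
  shows "l1_norm (Suc n) (u n) \<le> B10_norm u"
proof -
  have "Bseq (\<lambda>n. l1_norm (Suc n) (u n))"
    using B10_carrier_tendsto[OF assms] by (intro convergent_imp_Bseq convergentI)
  then have "bdd_above (range (\<lambda>n. l1_norm (Suc n) (u n)))" by (rule Bseq_bdd_above)
  then show ?thesis unfolding B10_norm_def by (intro cSUP_upper) simp_all
qed

lemma B10_norm_least: "(\<And>n. l1_norm (Suc n) (u n) \<le> K) \<Longrightarrow> B10_norm u \<le> K"
  unfolding B10_norm_def by (rule cSUP_least) simp_all

lemma B10_norm_nonneg: "u \<in> B10_carrier \<Longrightarrow> 0 \<le> B10_norm u"
  using B10_norm_upper[of u 0] l1_norm_nonneg[of "Suc 0" "u 0"] by linarith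

lemma norm_le_l1_norm: "i < n \<Longrightarrow> norm (a i) \<le> l1_norm n a"
  unfolding l1_norm_def by (rule member_le_sum) simp_all

lemma norm_le_B10_norm:
  assumes "u \<in> B10_carrier"
  shows "norm (u n i) \<le> B10_norm u"
proof (cases "n < i")
  case True
  then show ?thesis using B10_carrier_zero[OF assms True] B10_norm_nonneg[OF assms] by simp
next
  case False
  then have "norm (u n i) \<le> l1_norm (Suc n) (u n)" by (intro norm_le_l1_norm) simp
  also have "\<dots> \<le> B10_norm u" using assms by (rule B10_norm_upper)
  finally show ?thesis .
qed

lemma B10_add:
  assumes "u \<in> B10_carrier" "v \<in> B10_carrier"
  shows "(\<lambda>n i. u n i + v n i) \<in> B10_carrier"
proof (rule B10_carrierI)
  show "u n i + v n i = 0" if "n < i" for n i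
    using B10_carrier_zero[OF assms(1) that] B10_carrier_zero[OF assms(2) that] by simp
  have lim: "(\<lambda>n. l1_norm (Suc n) (u n) + l1_norm (Suc n) (v n)) \<longlonglongrightarrow> 0"
    using tendsto_add[OF B10_carrier_tendsto[OF assms(1)] B10_carrier_tendsto[OF assms(2)]] by simp
  have "norm (l1_norm (Suc n) (\<lambda>i. u n i + v n i)) \<le> l1_norm (Suc n) (u n) + l1_norm (Suc n) (v n)" for n
  proof -
    have "l1_norm (Suc n) (\<lambda>i. u n i + v n i) \<le> l1_norm (Suc n) (u n) + l1_norm (Suc n) (v n)"
      unfolding l1_norm_def sum.distrib[symmetric] by (intro sum_mono norm_triangle_ineq)
    then show ?thesis using l1_norm_nonneg[of "Suc n" "\<lambda>i. u n i + v n i"] by simp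
  qed
  then show "(\<lambda>n. l1_norm (Suc n) (\<lambda>i. u n i + v n i)) \<longlonglongrightarrow> 0"
    by (intro Lim_null_comparison[OF always_eventually lim] allI)
qed

lemma l1_norm_scale: "l1_norm n (\<lambda>i. c * a i) = norm c * l1_norm n a"
  by (simp add: l1_norm_def norm_mult sum_distrib_left)

lemma B10_scale:
  assumes "u \<in> B10_carrier"
  shows "(\<lambda>n i. c * u n i) \<in> B10_carrier"
proof (rule B10_carrierI)
  show "c * u n i = 0" if "n < i" for n i
    using B10_carrier_zero[OF assms that] by simp
  show "(\<lambda>n. l1_norm (Suc n) (\<lambda>i. c * u n i)) \<longlonglongrightarrow> 0"
    unfolding l1_norm_scale using tendsto_mult_left[OF B10_carrier_tendsto[OF assms], of "norm c"] by simp
qed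

lemma B10_zero: "(\<lambda>n i. 0) \<in> B10_carrier"
  by (rule B10_carrierI) (simp_all add: l1_norm_def)

lemma B10_diff:
  assumes "u \<in> B10_carrier" "v \<in> B10_carrier"
  shows "(\<lambda>n i. u n i - v n i) \<in> B10_carrier"
  using B10_add[OF assms(1) B10_scale[OF assms(2), of "-1"]] by simp

text \<open>The common form of the four hotel maps: block \<open>n\<close> of the image draws its
  entries from the blocks \<open>n\<close> and \<open>g n\<close>. The bound
  \<open>n \<le> h (g n)\<close> forces \<open>g\<close> to take each value only finitely often, so
  \<open>g n\<close> tends to infinity and the block norms stay a null sequence.\<close>

lemma B10_dominated:
  assumes u: "u \<in> B10_carrier" and h: "\<And>n. n \<le> h (g n)"
    and 0: "\<And>n i. n < i \<Longrightarrow> v n i = 0"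
    and le: "\<And>n i. norm (v n i) \<le> norm (u n i) + norm (u (g n) i)"
  shows "v \<in> B10_carrier" "B10_norm v \<le> 2 * B10_norm u"
proof -
  have trunc: "(\<Sum>i<k. norm (u m i)) \<le> l1_norm (Suc m) (u m)" for k m
  proof -
    have "(\<Sum>i<k. norm (u m i)) \<le> (\<Sum>i<max k (Suc m). norm (u m i))"
      by (rule sum_mono2) simp_all
    also have "\<dots> = (\<Sum>i<Suc m. norm (u m i))"
      by (rule sum.mono_neutral_right) (use B10_carrier_zero[OF u] in simp_all)
    finally show ?thesis by (simp add: l1_norm_def)
  qed
  have b: "l1_norm (Suc n) (v n) \<le> l1_norm (Suc n) (u n) + l1_norm (Suc (g n)) (u (g n))" for n
  proof -
    have "l1_norm (Suc n) (v n) \<le> (\<Sum>i<Suc n. norm (u n i) + norm (u (g n) i))"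
      unfolding l1_norm_def by (intro sum_mono le)
    also have "\<dots> = l1_norm (Suc n) (u n) + (\<Sum>i<Suc n. norm (u (g n) i))"
      unfolding l1_norm_def by (rule sum.distrib)
    finally show ?thesis using trunc[of "g n" "Suc n"] by linarith
  qed
  have g: "filterlim g at_top sequentially"
    unfolding filterlim_at_top
  proof
    fix M
    define N where "N = Suc (Max (h ` {..<M}))"
    have "M \<le> g n" if "N \<le> n" for n
    proof (rule ccontr)
      assume "\<not> M \<le> g n"
      then have "h (g n) \<le> Max (h ` {..<M})" by (intro Max_ge) simp_all
      then show False using h[of n] that by (simp add: N_def)
    qed
    then show "\<forall>\<^sub>F n in sequentially. M \<le> g n" by (rule eventually_sequentiallyI)
  qed
  have "(\<lambda>n. l1_norm (Suc (g n)) (u (g n))) \<longlonglongrightarrow> 0"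
    using filterlim_compose[OF B10_carrier_tendsto[OF u] g] .
  then have lim: "(\<lambda>n. l1_norm (Suc n) (u n) + l1_norm (Suc (g n)) (u (g n))) \<longlonglongrightarrow> 0"
    using tendsto_add[OF B10_carrier_tendsto[OF u]] by fastforce
  have "norm (l1_norm (Suc n) (v n)) \<le> l1_norm (Suc n) (u n) + l1_norm (Suc (g n)) (u (g n))" for n
    using b[of n] l1_norm_nonneg[of "Suc n" "v n"] by simp
  then show "v \<in> B10_carrier"
    by (intro B10_carrierI 0 Lim_null_comparison[OF always_eventually lim] allI)
  show "B10_norm v \<le> 2 * B10_norm u"
  proof (rule B10_norm_least)
    fix n
    show "l1_norm (Suc n) (v n) \<le> 2 * B10_norm u"
      using b[of n] B10_norm_upper[OF u, of n] B10_norm_upper[OF u, of "g n"] by linarith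
  qed
qed

section \<open>Absorbing one more copy of the sum\<close>

text \<open>A Hilbert hotel on \<^const>\<open>B10_carrier\<close>: for each \<open>k\<close>, the first \<open>Suc j\<close> coordinates of the
  blocks numbered \<open>prod_encode (j, k)\<close> form a copy of the whole space, because
  \<open>j \<le> prod_encode (j, k)\<close>.\<close>

definition hotel_shift :: "(nat \<Rightarrow> nat \<Rightarrow> 'f::real_normed_field) \<Rightarrow> nat \<Rightarrow> nat \<Rightarrow> 'f" where
  "hotel_shift u n i = (case prod_decode n of (j, k) \<Rightarrow>
     if j < i then u n i else if k = 0 then 0 else u (prod_encode (j, k - 1)) i)"

text \<open>Only a left inverse of \<open>hotel_shift\<close>: it forgets copy 0, which
  \<open>hotel_out\<close> reads off. Entries with \<open>j < i\<close> lie in no copy and stay in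
  place.\<close>

definition hotel_unshift :: "(nat \<Rightarrow> nat \<Rightarrow> 'f::real_normed_field) \<Rightarrow> nat \<Rightarrow> nat \<Rightarrow> 'f" where
  "hotel_unshift u n i = (case prod_decode n of (j, k) \<Rightarrow>
     if j < i then u n i else u (prod_encode (j, Suc k)) i)"

definition hotel_in :: "(nat \<Rightarrow> nat \<Rightarrow> 'f::real_normed_field) \<Rightarrow> nat \<Rightarrow> nat \<Rightarrow> 'f" where
  "hotel_in u n i = (case prod_decode n of (j, k) \<Rightarrow> if k = 0 \<and> i \<le> j then u j i else 0)"

definition hotel_out :: "(nat \<Rightarrow> nat \<Rightarrow> 'f::real_normed_field) \<Rightarrow> nat \<Rightarrow> nat \<Rightarrow> 'f" where
  "hotel_out u n i = (if i \<le> n then u (prod_encode (n, 0)) i else 0)"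

lemma fst_le_prod_encode: "j \<le> prod_encode (j, k)"
  by (simp add: prod_encode_def)

lemma prod_decode_fst_le: "prod_decode n = (j, k) \<Longrightarrow> j \<le> n"
  using fst_le_prod_encode[of j k] prod_decode_inverse[of n] by simp

lemma prod_encode_Suc: "prod_encode (j, Suc k) = prod_encode (j, k) + Suc (j + k)"
  by (simp add: prod_encode_def)

lemma le_triangle: "n \<le> triangle n"
  by (induction n) simp_all

lemma hotel_shift_carrier:
  assumes "u \<in> B10_carrier"
  shows "hotel_shift u \<in> B10_carrier" "B10_norm (hotel_shift u) \<le> 2 * B10_norm u"
proof -
  define g where "g n = (case prod_decode n of (j, k) \<Rightarrow> prod_encode (j, k - 1))" for n
  \<comment> \<open>One copy further the index grows by \<open>Suc (j + k')\<close>, and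
    \<open>j + k'\<close> is at most \<open>triangle (j + k')\<close>, hence at most the old index.
    In copy 0 the truncated \<open>k - 1\<close> makes \<open>g n = n\<close>.\<close>
  have h: "n \<le> 2 * g n + 1" for n
  proof (cases "prod_decode n")
    case (Pair j k)
    then have n: "n = prod_encode (j, k)" using prod_decode_inverse[of n] by simp
    have "prod_encode (j, Suc k') \<le> 2 * prod_encode (j, k') + 1" for k'
      using le_triangle[of "j + k'"] unfolding prod_encode_Suc by (simp add: prod_encode_def)
    then show ?thesis unfolding g_def Pair n by (cases k) simp_all
  qed
  have 0: "hotel_shift u n i = 0" if "n < i" for n i
    using that B10_carrier_zero[OF assms that] prod_decode_fst_le[of n]
    by (cases "prod_decode n") (fastforce simp: hotel_shift_def)
  have "norm (hotel_shift u n i) \<le> norm (u n i) + norm (u (g n) i)" for n i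
    by (cases "prod_decode n") (simp add: hotel_shift_def g_def)
  from B10_dominated[where h = "\<lambda>m. 2 * m + 1", OF assms h 0 this]
  show "hotel_shift u \<in> B10_carrier" "B10_norm (hotel_shift u) \<le> 2 * B10_norm u" by blast+
qed

lemma hotel_unshift_carrier:
  assumes "u \<in> B10_carrier"
  shows "hotel_unshift u \<in> B10_carrier" "B10_norm (hotel_unshift u) \<le> 2 * B10_norm u"
proof -
  define g where "g n = (case prod_decode n of (j, k) \<Rightarrow> prod_encode (j, Suc k))" for n
  have h: "n \<le> g n" for n
  proof (cases "prod_decode n")
    case (Pair j k)
    then have n: "n = prod_encode (j, k)" using prod_decode_inverse[of n] by simp
    show ?thesis unfolding g_def Pair by (simp add: prod_encode_Suc n)
  qed
  have 0: "hotel_unshift u n i = 0" if "n < i" for n i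
    using that B10_carrier_zero[OF assms that] prod_decode_fst_le[of n]
    by (cases "prod_decode n") (fastforce simp: hotel_unshift_def)
  have "norm (hotel_unshift u n i) \<le> norm (u n i) + norm (u (g n) i)" for n i
    by (cases "prod_decode n") (simp add: hotel_unshift_def g_def)
  from B10_dominated[where h = "\<lambda>m. m", OF assms h 0 this]
  show "hotel_unshift u \<in> B10_carrier" "B10_norm (hotel_unshift u) \<le> 2 * B10_norm u" by blast+
qed

lemma hotel_in_carrier:
  assumes "u \<in> B10_carrier"
  shows "hotel_in u \<in> B10_carrier" "B10_norm (hotel_in u) \<le> 2 * B10_norm u"
proof -
  \<comment> \<open>Blocks outside copy 0 receive nothing; the default value \<open>n\<close> is
    there to keep \<open>g\<close> tending to infinity.\<close>
  define g where "g n = (case prod_decode n of (j, k) \<Rightarrow> if k = 0 then j else n)" for n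
  have h: "n \<le> prod_encode (g n, 0)" for n
  proof (cases "prod_decode n")
    case (Pair j k)
    then have n: "n = prod_encode (j, k)" using prod_decode_inverse[of n] by simp
    show ?thesis
    proof (cases "k = 0")
      case True
      then show ?thesis unfolding g_def Pair using n by simp
    next
      case False
      then show ?thesis unfolding g_def Pair using fst_le_prod_encode[of n 0] by simp
    qed
  qed
  have 0: "hotel_in u n i = 0" if "n < i" for n i
    using that prod_decode_fst_le[of n]
    by (cases "prod_decode n") (fastforce simp: hotel_in_def)
  have "norm (hotel_in u n i) \<le> norm (u n i) + norm (u (g n) i)" for n i
    by (cases "prod_decode n") (simp add: hotel_in_def g_def)
  from B10_dominated[where h = "\<lambda>m. prod_encode (m, 0)", OF assms h 0 this]
  show "hotel_in u \<in> B10_carrier" "B10_norm (hotel_in u) \<le> 2 * B10_norm u" by blast+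
qed

lemma hotel_out_carrier:
  assumes "u \<in> B10_carrier"
  shows "hotel_out u \<in> B10_carrier" "B10_norm (hotel_out u) \<le> 2 * B10_norm u"
proof -
  have 0: "hotel_out u n i = 0" if "n < i" for n i
    using that by (simp add: hotel_out_def)
  have "norm (hotel_out u n i) \<le> norm (u n i) + norm (u (prod_encode (n, 0)) i)" for n i
    by (simp add: hotel_out_def)
  from B10_dominated[where h = "\<lambda>m. m", OF assms fst_le_prod_encode 0 this]
  show "hotel_out u \<in> B10_carrier" "B10_norm (hotel_out u) \<le> 2 * B10_norm u" by blast+
qed

text \<open>This identity and the next four say that sending \<open>(u, v)\<close> to the sum of
  \<open>hotel_shift u\<close> and \<open>hotel_in v\<close> is an isomorphism of the square of
  \<open>B10_carrier\<close> onto \<open>B10_carrier\<close>, whose inverse has the components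
  \<open>hotel_unshift\<close> and \<open>hotel_out\<close>.\<close>

lemma hotel_unshift_shift: "hotel_unshift (hotel_shift u) = u"
proof (intro ext)
  show "hotel_unshift (hotel_shift u) n i = u n i" for n i
    using prod_decode_inverse[of n]
    by (cases "prod_decode n") (simp add: hotel_unshift_def hotel_shift_def)
qed

lemma hotel_out_in:
  assumes "u \<in> B10_carrier"
  shows "hotel_out (hotel_in u) = u"
proof (intro ext)
  show "hotel_out (hotel_in u) n i = u n i" for n i
    using B10_carrier_zero[OF assms, of n i] by (simp add: hotel_out_def hotel_in_def)
qed

lemma hotel_unshift_in: "hotel_unshift (hotel_in u) = (\<lambda>n i. 0)"
proof (intro ext)
  show "hotel_unshift (hotel_in u) n i = 0" for n i
    by (cases "prod_decode n") (simp add: hotel_unshift_def hotel_in_def)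
qed

lemma hotel_out_shift: "hotel_out (hotel_shift u) = (\<lambda>n i. 0)"
proof (intro ext)
  show "hotel_out (hotel_shift u) n i = 0" for n i
    by (simp add: hotel_out_def hotel_shift_def)
qed

lemma hotel_decomposition: "hotel_shift (hotel_unshift u) n i + hotel_in (hotel_out u) n i = u n i"
proof (cases "prod_decode n")
  case (Pair j k)
  then have n: "n = prod_encode (j, k)" using prod_decode_inverse[of n] by simp
  show ?thesis
  proof (cases k)
    case 0
    then show ?thesis by (simp add: n hotel_shift_def hotel_unshift_def hotel_in_def hotel_out_def)
  next
    case (Suc k')
    then show ?thesis by (simp add: n hotel_shift_def hotel_unshift_def hotel_in_def hotel_out_def)
  qed
qed

lemma hotel_add:
  "hotel_shift (\<lambda>n i. u n i + v n i) = (\<lambda>n i. hotel_shift u n i + hotel_shift v n i)"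
  "hotel_unshift (\<lambda>n i. u n i + v n i) = (\<lambda>n i. hotel_unshift u n i + hotel_unshift v n i)"
  "hotel_in (\<lambda>n i. u n i + v n i) = (\<lambda>n i. hotel_in u n i + hotel_in v n i)"
  "hotel_out (\<lambda>n i. u n i + v n i) = (\<lambda>n i. hotel_out u n i + hotel_out v n i)"
  by (intro ext; simp add: hotel_shift_def hotel_unshift_def hotel_in_def hotel_out_def
    split: prod.split)+

lemma hotel_scale:
  "hotel_shift (\<lambda>n i. c * u n i) = (\<lambda>n i. c * hotel_shift u n i)"
  "hotel_unshift (\<lambda>n i. c * u n i) = (\<lambda>n i. c * hotel_unshift u n i)"
  "hotel_in (\<lambda>n i. c * u n i) = (\<lambda>n i. c * hotel_in u n i)"
  "hotel_out (\<lambda>n i. c * u n i) = (\<lambda>n i. c * hotel_out u n i)"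
  by (intro ext; simp add: hotel_shift_def hotel_unshift_def hotel_in_def hotel_out_def
    split: prod.split)+

section \<open>The tree basis of the sum\<close>

text \<open>The tree bases of the blocks are enumerated by \<open>k = prod_encode (i, n - i)\<close>, \<open>i \<le> n\<close>, where \<open>n\<close> is
  the block and \<open>i\<close> the position in it. Since \<open>prod_encode (i, n - i) = triangle n + i\<close>, this runs
  through the blocks one after the other.\<close>

definition tree_coord :: "nat \<Rightarrow> (nat \<Rightarrow> nat \<Rightarrow> 'f::real_normed_field) \<Rightarrow> 'f" where
  "tree_coord k u = (case prod_decode k of (i, d) \<Rightarrow> tree_sum (u (i + d)) i)"

definition tree_vec :: "nat \<Rightarrow> nat \<Rightarrow> nat \<Rightarrow> 'f::real_normed_field" where
  "tree_vec k n j = (case prod_decode k of (i, d) \<Rightarrow>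
     if n = i + d \<and> j \<le> n then tree_diff (\<lambda>l. if l = i then 1 else 0) j else 0)"

definition tree_proj ::
  "nat set \<Rightarrow> (nat \<Rightarrow> nat \<Rightarrow> 'f::real_normed_field) \<Rightarrow> nat \<Rightarrow> nat \<Rightarrow> 'f" where
  "tree_proj A u n j = (if j \<le> n
     then tree_diff (\<lambda>i. if prod_encode (i, n - i) \<in> A then tree_sum (u n) i else 0) j else 0)"

lemma tree_coord_encode: "i \<le> n \<Longrightarrow> tree_coord (prod_encode (i, n - i)) u = tree_sum (u n) i"
  by (simp add: tree_coord_def)

lemma tree_diff_add_scale: "tree_diff (\<lambda>i. z i + c * w i) j = tree_diff z j + c * tree_diff w j"
  by (cases j) (simp_all add: algebra_simps)

lemma tree_diff_diff: "tree_diff (\<lambda>i. z i - w i) j = tree_diff z j - tree_diff w j"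
  using tree_diff_add_scale[of z "-1" w j] by simp

lemma tree_sum_add_scale: "tree_sum (\<lambda>i. z i + c * w i) j = tree_sum z j + c * tree_sum w j"
proof -
  define y where "y i = tree_sum z i + c * tree_sum w i" for i
  have "tree_diff y i = z i + c * w i" for i
    unfolding y_def tree_diff_add_scale by simp
  then have "tree_sum (\<lambda>i. z i + c * w i) j = y j" by (intro tree_sum_tree_diff) simp
  then show ?thesis by (simp add: y_def)
qed

lemma tree_coord_add:
  fixes u v :: "nat \<Rightarrow> nat \<Rightarrow> 'f::real_normed_field"
  shows "tree_coord k (\<lambda>n i. u n i + v n i) = tree_coord k u + tree_coord k v"
proof -
  have "tree_sum (\<lambda>i. x i + y i) j = tree_sum x j + tree_sum y j" for x y :: "nat \<Rightarrow> 'f" and j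
    using tree_sum_add_scale[of x 1 y j] by simp
  then show ?thesis by (simp add: tree_coord_def split: prod.split)
qed

lemma tree_coord_scale: "tree_coord k (\<lambda>n i. c * u n i) = c * tree_coord k u"
proof -
  have "tree_sum (\<lambda>i. 0) j = (0 :: 'a)" for j
    using tree_sum_add_scale[of "\<lambda>i. 0 :: 'a" "-1" "\<lambda>i. 0" j] by simp
  then have "tree_sum (\<lambda>i. c * w i) j = c * tree_sum w j" for w :: "nat \<Rightarrow> 'a" and j
    using tree_sum_add_scale[of "\<lambda>i. 0" c w j] by simp
  then show ?thesis by (simp add: tree_coord_def split: prod.split)
qed

lemma norm_tree_coord_le:
  assumes "u \<in> B10_carrier"
  shows "norm (tree_coord k u) \<le> 2 * B10_norm u"
  unfolding tree_coord_def
  by (cases "prod_decode k") (simp add: norm_tree_sum_le norm_le_B10_norm[OF assms])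

lemma tree_coord_vec: "tree_coord l (tree_vec k) = (if l = k then 1 else 0)"
proof -
  obtain i d where k: "prod_decode k = (i, d)" by (cases "prod_decode k")
  obtain j e where l: "prod_decode l = (j, e)" by (cases "prod_decode l")
  have lk: "l = k \<longleftrightarrow> (j, e) = (i, d)"
    using prod_decode_inverse[of k] prod_decode_inverse[of l] k l by (metis)
  show ?thesis
  proof (cases "j + e = i + d")
    case True
    have "tree_sum (tree_vec k (j + e)) j = (if j = i then 1 else 0 :: 'a)"
      using True by (intro tree_sum_tree_diff) (simp add: tree_vec_def k)
    then show ?thesis using True unfolding lk by (simp add: tree_coord_def l)
  next
    case False
    have "tree_vec k (j + e) i' = (0 :: 'a)" for i' using False by (simp add: tree_vec_def k)
    moreover have "tree_diff (\<lambda>i. 0 :: 'a) i' = 0" for i' by (cases i') simp_all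
    ultimately have "tree_sum (tree_vec k (j + e)) j = (0 :: 'a)"
      by (intro tree_sum_tree_diff) simp
    then show ?thesis using False unfolding lk by (auto simp: tree_coord_def l)
  qed
qed

lemma tree_vec_carrier:
  "(tree_vec k :: nat \<Rightarrow> nat \<Rightarrow> 'f::real_normed_field) \<in> B10_carrier"
  "B10_norm (tree_vec k :: nat \<Rightarrow> nat \<Rightarrow> 'f::real_normed_field) \<le> 2"
proof -
  obtain i d where k: "prod_decode k = (i, d)" by (cases "prod_decode k")
  define w where "w l = (if l = i then 1 else 0 :: 'f)" for l
  have one: "(\<Sum>j<m. norm (w j)) \<le> 1" for m
  proof -
    have "(\<Sum>j<m. norm (w j)) = (\<Sum>j<m. if j = i then 1 else 0)"
      by (rule sum.cong) (simp_all add: w_def)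
    also have "\<dots> \<le> 1" by (simp add: sum.delta')
    finally show ?thesis .
  qed
  have b: "(\<Sum>j<Suc n. norm (tree_diff w j)) \<le> 2" for n
  proof -
    have "(\<Sum>j<Suc n. norm (tree_diff w j)) = norm (w 0) + (\<Sum>j<n. norm (tree_diff w (Suc j)))"
      by (subst sum.lessThan_Suc_shift) simp
    also have "\<dots> \<le> norm (w 0) + (\<Sum>j<n. norm (w (Suc j)) + norm (w (j div 2)) / 2)"
    proof (intro add_mono sum_mono order_refl)
      show "norm (tree_diff w (Suc j)) \<le> norm (w (Suc j)) + norm (w (j div 2)) / 2" for j
        using norm_triangle_ineq4[of "w (Suc j)" "w (j div 2) / 2"] by (simp add: norm_divide)
    qed
    also have "\<dots> = (\<Sum>j<Suc n. norm (w j)) + (\<Sum>j<n. norm (w (j div 2))) / 2"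
      unfolding sum.lessThan_Suc_shift by (simp add: sum.distrib sum_divide_distrib)
    also have "\<dots> \<le> 1 + 1"
      using one[of "Suc n"] one[of n] sum_div2_le[of "\<lambda>j. norm (w j)" n] by simp
    finally show ?thesis by simp
  qed
  have eq: "l1_norm (Suc n) (tree_vec k n :: nat \<Rightarrow> 'f) = (if n = i + d then \<Sum>j<Suc n. norm (tree_diff w j) else 0)" for n
  proof -
    have "l1_norm (Suc n) (tree_vec k n :: nat \<Rightarrow> 'f) = (\<Sum>j<Suc n. if n = i + d then norm (tree_diff w j) else 0)"
      unfolding l1_norm_def by (intro sum.cong) (simp_all add: tree_vec_def k w_def[abs_def])
    then show ?thesis by simp
  qed
  show "(tree_vec k :: nat \<Rightarrow> nat \<Rightarrow> 'f) \<in> B10_carrier"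
  proof (rule B10_carrierI)
    show "tree_vec k n j = (0 :: 'f)" if "n < j" for n j using that by (simp add: tree_vec_def k)
    have "\<forall>\<^sub>F n in sequentially. l1_norm (Suc n) (tree_vec k n :: nat \<Rightarrow> 'f) = 0"
      unfolding eq by (rule eventually_sequentiallyI[of "Suc (i + d)"]) simp
    then show "(\<lambda>n. l1_norm (Suc n) (tree_vec k n :: nat \<Rightarrow> 'f)) \<longlonglongrightarrow> 0"
      by (rule tendsto_eventually)
  qed
  show "B10_norm (tree_vec k :: nat \<Rightarrow> nat \<Rightarrow> 'f) \<le> 2"
  proof (rule B10_norm_least)
    show "l1_norm (Suc n) (tree_vec k n :: nat \<Rightarrow> 'f) \<le> 2" for n
      unfolding eq by (cases "n = i + d") (simp_all add: b del: sum.lessThan_Suc)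
  qed
qed

lemma tree_proj_empty: "tree_proj {} u = (\<lambda>n i. 0)"
proof (intro ext)
  show "tree_proj {} u n i = 0" for n i by (cases i) (simp_all add: tree_proj_def)
qed

text \<open>The projection is defined block by block, so that the tree inequalities apply to it
  directly. For finite sets this recursion identifies it with the sum of coordinates times basis
  vectors.\<close>

lemma tree_proj_insert:
  assumes "k \<notin> A"
  shows "tree_proj (insert k A) u = (\<lambda>n i. tree_proj A u n i + tree_coord k u * tree_vec k n i)"
proof (intro ext)
  fix n j
  obtain i d where k: "prod_decode k = (i, d)" by (cases "prod_decode k")
  then have ki: "k = prod_encode (i, d)" using prod_decode_inverse[of k] by simp
  show "tree_proj (insert k A) u n j = tree_proj A u n j + tree_coord k u * tree_vec k n j"
  proof (cases "j \<le> n")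
    case False
    then show ?thesis by (simp add: tree_proj_def tree_vec_def k)
  next
    case j: True
    show ?thesis
    proof (cases "n = i + d")
      case n: True
      have iff: "prod_encode (l, n - l) = k \<longleftrightarrow> l = i" if "l \<le> n" for l
        using that n unfolding ki by (simp add: prod_encode_eq) linarith
      have "tree_diff (\<lambda>l. if prod_encode (l, n - l) \<in> insert k A then tree_sum (u n) l else 0) j
        = tree_diff (\<lambda>l. (if prod_encode (l, n - l) \<in> A then tree_sum (u n) l else 0)
            + tree_sum (u n) i * (if l = i then 1 else 0)) j"
      proof (rule tree_diff_cong)
        fix l assume "l \<le> j"
        then have "l \<le> n" using j by simp
        then show "(if prod_encode (l, n - l) \<in> insert k A then tree_sum (u n) l else 0)
          = (if prod_encode (l, n - l) \<in> A then tree_sum (u n) l else 0)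
            + tree_sum (u n) i * (if l = i then 1 else 0)"
          using iff[of l] assms by (cases "l = i") simp_all
      qed
      then show ?thesis unfolding tree_diff_add_scale
        using j by (simp add: tree_proj_def tree_vec_def tree_coord_def k n[symmetric])
    next
      case n: False
      have "prod_encode (l, n - l) \<noteq> k" if "l \<le> n" for l
        using that n unfolding ki by (simp add: prod_encode_eq) linarith
      then have "tree_diff (\<lambda>l. if prod_encode (l, n - l) \<in> insert k A then tree_sum (u n) l else 0) j
        = tree_diff (\<lambda>l. if prod_encode (l, n - l) \<in> A then tree_sum (u n) l else 0) j"
        using j by (intro tree_diff_cong) simp
      then show ?thesis using j n by (simp add: tree_proj_def tree_vec_def k)
    qed
  qed
qed

lemma tree_proj_carrier: "finite A \<Longrightarrow> tree_proj A u \<in> B10_carrier"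
proof (induction A rule: finite_induct)
  case empty
  then show ?case by (simp add: tree_proj_empty B10_zero)
next
  case (insert k A)
  show ?case unfolding tree_proj_insert[OF insert.hyps(2)]
    by (intro B10_add B10_scale insert.IH tree_vec_carrier)
qed

lemma diff_tree_proj:
  "j \<le> n \<Longrightarrow> u n j - tree_proj A u n j
    = tree_diff (\<lambda>i. if prod_encode (i, n - i) \<in> A then 0 else tree_sum (u n) i) j"
proof -
  assume j: "j \<le> n"
  have "(\<lambda>i. if prod_encode (i, n - i) \<in> A then 0 else tree_sum (u n) i)
    = (\<lambda>i. tree_sum (u n) i - (if prod_encode (i, n - i) \<in> A then tree_sum (u n) i else 0))"
    by (rule ext) simp
  then show ?thesis using j by (simp only: tree_diff_diff) (simp add: tree_proj_def)
qed

text \<open>A greedy set cuts out a greedy set in every block, and the norm is a supremum over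
  blocks, so the constant of a single block survives.\<close>

lemma tree_proj_greedy:
  assumes u: "u \<in> B10_carrier"
    and gr: "\<And>j k. j \<notin> A \<Longrightarrow> k \<in> A \<Longrightarrow> norm (tree_coord j u) \<le> norm (tree_coord k u)"
  shows "B10_norm (\<lambda>n i. u n i - tree_proj A u n i) \<le> 6 * B10_norm u"
proof (rule B10_norm_least)
  fix n
  define E where "E = {i. prod_encode (i, n - i) \<in> A}"
  have "l1_norm (Suc n) (\<lambda>i. u n i - tree_proj A u n i)
      = (\<Sum>i<Suc n. norm (tree_diff (\<lambda>i. if i \<in> E then 0 else tree_sum (u n) i) i))"
    unfolding l1_norm_def E_def by (intro sum.cong) (simp_all add: diff_tree_proj)
  also have "\<dots> \<le> 6 * (\<Sum>i<Suc n. norm (tree_diff (tree_sum (u n)) i))"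
  proof (rule tree_greedy)
    fix j k assume "j < Suc n" "k < Suc n" "j \<notin> E" "k \<in> E"
    then show "norm (tree_sum (u n) j) \<le> norm (tree_sum (u n) k)"
      using gr[of "prod_encode (j, n - j)" "prod_encode (k, n - k)"]
      by (simp add: E_def tree_coord_encode)
  qed
  also have "\<dots> = 6 * l1_norm (Suc n) (u n)"
    by (simp only: tree_diff_tree_sum l1_norm_def)
  also have "\<dots> \<le> 6 * B10_norm u" using B10_norm_upper[OF u, of n] by simp
  finally show "l1_norm (Suc n) (\<lambda>i. u n i - tree_proj A u n i) \<le> 6 * B10_norm u" .
qed

lemma tree_proj_lessThan_le:
  "l1_norm (Suc n) (\<lambda>i. u n i - tree_proj {..<N} u n i) \<le> 3 * l1_norm (Suc n) (u n)"
proof -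
  \<comment> \<open>Block \<open>n\<close> starts at index \<open>triangle n\<close>, so the first
    \<open>N\<close> basis vectors meet it in its first \<open>k\<close> nodes. Truncated
    subtraction gives 0 for blocks not yet reached, and \<open>k\<close> may exceed the length of a
    block already exhausted.\<close>
  define k where "k = N - triangle n"
  have enc: "prod_encode (i, n - i) < N \<longleftrightarrow> i < k" if "i \<le> n" for i
    using that unfolding k_def prod_encode_def by simp linarith
  have "l1_norm (Suc n) (\<lambda>i. u n i - tree_proj {..<N} u n i)
      \<le> l1_norm (Suc n) (u n) + (\<Sum>i<Suc n. norm (tree_proj {..<N} u n i))"
    unfolding l1_norm_def sum.distrib[symmetric] by (intro sum_mono norm_triangle_ineq4)
  also have "(\<Sum>i<Suc n. norm (tree_proj {..<N} u n i))
      = (\<Sum>i<Suc n. norm (tree_diff (\<lambda>i. if i < k then tree_sum (u n) i else 0) i))"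
  proof (intro sum.cong refl arg_cong[where f = norm])
    fix j assume "j \<in> {..<Suc n}"
    then have j: "j \<le> n" by simp
    have "tree_diff (\<lambda>i. if prod_encode (i, n - i) \<in> {..<N} then tree_sum (u n) i else 0) j
      = tree_diff (\<lambda>i. if i < k then tree_sum (u n) i else 0) j"
      using enc j by (intro tree_diff_cong) simp
    then show "tree_proj {..<N} u n j = tree_diff (\<lambda>i. if i < k then tree_sum (u n) i else 0) j"
      using j by (simp add: tree_proj_def)
  qed
  also have "\<dots> \<le> 2 * (\<Sum>i<Suc n. norm (tree_diff (tree_sum (u n)) i))"
    by (rule tree_partial_sum)
  also have "\<dots> = 2 * l1_norm (Suc n) (u n)"
    by (simp only: tree_diff_tree_sum l1_norm_def)
  finally show ?thesis by simp
qed

lemma tree_proj_lessThan_eq: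
  assumes "triangle n + n < N" "i \<le> n"
  shows "tree_proj {..<N} u n i = u n i"
proof -
  have "tree_diff (\<lambda>i. if prod_encode (i, n - i) \<in> {..<N} then 0 else tree_sum (u n) i) i
    = tree_diff (\<lambda>i. 0) i"
    using assms by (intro tree_diff_cong) (simp add: prod_encode_def)
  also have "\<dots> = 0" by (cases i) simp_all
  finally show ?thesis using diff_tree_proj[OF assms(2), of u "{..<N}"] by simp
qed

lemma tree_proj_tendsto:
  assumes u: "u \<in> B10_carrier"
  shows "(\<lambda>N. B10_norm (\<lambda>n i. u n i - tree_proj {..<N} u n i)) \<longlonglongrightarrow> 0"
proof (rule LIMSEQ_I)
  fix e :: real assume e: "0 < e"
  \<comment> \<open>Late blocks are controlled by the uniform factor 3 of
    \<open>tree_proj_lessThan_le\<close>; \<open>e / 6\<close> leaves room for a strict inequality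
    after the supremum. The blocks before \<open>M\<close> are reproduced exactly once
    \<open>N\<close> reaches \<open>triangle M\<close>.\<close>
  then have "\<exists>M. \<forall>n\<ge>M. norm (l1_norm (Suc n) (u n) - 0) < e / 6"
    using LIMSEQ_D[OF B10_carrier_tendsto[OF u], of "e / 6"] by simp
  then obtain M where M: "\<And>n. M \<le> n \<Longrightarrow> l1_norm (Suc n) (u n) < e / 6" by fastforce
  have "norm (B10_norm (\<lambda>n i. u n i - tree_proj {..<N} u n i) - 0) < e" if N: "triangle M \<le> N" for N
  proof -
    have "B10_norm (\<lambda>n i. u n i - tree_proj {..<N} u n i) \<le> e / 2"
    proof (rule B10_norm_least)
      fix n
      show "l1_norm (Suc n) (\<lambda>i. u n i - tree_proj {..<N} u n i) \<le> e / 2"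
      proof (cases "M \<le> n")
        case True
        then show ?thesis using tree_proj_lessThan_le[of n u N] M[of n] by simp
      next
        case False
        have mono: "a \<le> b \<Longrightarrow> triangle a \<le> triangle b" for a b
          by (induction rule: dec_induct) simp_all
        have "triangle (Suc n) \<le> triangle M" using False by (intro mono) simp
        then have "triangle n + n < N" using N by simp
        then have "l1_norm (Suc n) (\<lambda>i. u n i - tree_proj {..<N} u n i) = 0"
          unfolding l1_norm_def using tree_proj_lessThan_eq[of n N _ u] by (intro sum.neutral) simp
        then show ?thesis using e by simp
      qed
    qed
    moreover have "0 \<le> B10_norm (\<lambda>n i. u n i - tree_proj {..<N} u n i)"
      by (intro B10_norm_nonneg B10_diff u tree_proj_carrier) simp
    ultimately show ?thesis using e by simp
  qed
  then show "\<exists>no. \<forall>N\<ge>no. norm (B10_norm (\<lambda>n i. u n i - tree_proj {..<N} u n i) - 0) < e" by blast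
qed

section \<open>Logarithmic growth inside a block\<close>

text \<open>In the block \<open>4 * m\<close>, the vector with tree coordinates \<open>1 / (i + 1)\<close> has norm at most 2 since
  its entries telescope, whereas keeping only the coordinates at even positions destroys the
  cancellation between \<open>p\<close> and \<open>2 * p + 1\<close> for all even \<open>p\<close>.\<close>

lemma ex_tree_proj_ge_ln:
  "\<exists>(u :: nat \<Rightarrow> nat \<Rightarrow> 'f::real_normed_field) \<in> B10_carrier. \<exists>A. finite A \<and> 1 \<le> B10_norm u \<and> B10_norm u \<le> 2 \<and>
     (\<forall>k>triangle (4 * m) + 4 * m. tree_coord k u = 0) \<and>
     ln (real m + 1) / 4 \<le> B10_norm (tree_proj A u)"
proof -
  define n where "n = 4 * m"
  define r where "r i = 1 / (real i + 1)" for i :: nat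
  define z where "z i = (of_real (r i) :: 'f)" for i
  define u where "u k j = (if k = n \<and> j \<le> n then tree_diff z j else 0)" for k j
  \<comment> \<open>The first component of a decoded index is the position in its block. The upper
    bound makes \<open>A\<close> finite; of the blocks it admits, only block \<open>n\<close>
    carries entries of \<open>u\<close>.\<close>
  define A where "A = {k. k \<le> triangle n + n \<and> even (fst (prod_decode k))}"
  have r0: "0 < r i" for i by (simp add: r_def)
  have pair: "norm (tree_diff z (Suc i)) \<le> r i - r (Suc i)" for i
  proof -
    have "norm (tree_diff z (Suc i)) = norm (of_real (r (Suc i) - r (i div 2) / 2) :: 'f)"
      by (simp add: z_def)
    also have "\<dots> = \<bar>r (Suc i) - r (i div 2) / 2\<bar>" by (rule norm_of_real)
    \<comment> \<open>A left child has entry 0; at a right child, half of the parent's value equals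
      the value at the left sibling \<open>i\<close>.\<close>
    also have "\<dots> \<le> r i - r (Suc i)"
    proof (cases "even i")
      case True
      then obtain p where p: "i = 2 * p" by (rule evenE)
      have "r (Suc i) - r (i div 2) / 2 = 0" by (simp add: p r_def field_simps)
      moreover have "r (Suc i) \<le> r i" by (simp add: r_def frac_le)
      ultimately show ?thesis by simp
    next
      case False
      then obtain p where p: "i = 2 * p + 1" by (rule oddE)
      have "r (i div 2) / 2 = r i" by (simp add: p r_def field_simps)
      moreover have "r (Suc i) \<le> r i" by (simp add: r_def frac_le)
      ultimately show ?thesis by simp
    qed
    finally show ?thesis .
  qed
  have l1u: "l1_norm (Suc k) (u k) = (if k = n then \<Sum>j<Suc n. norm (tree_diff z j) else 0)" for k
  proof (cases "k = n")
    case True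
    then show ?thesis unfolding l1_norm_def True by (simp add: u_def del: sum.lessThan_Suc)
  next
    case False
    then show ?thesis by (simp add: l1_norm_def u_def)
  qed
  have u: "u \<in> B10_carrier"
  proof (rule B10_carrierI)
    show "u k j = 0" if "k < j" for k j
    proof -
      have "\<not> (k = n \<and> j \<le> n)" using that by linarith
      then show ?thesis unfolding u_def by (rule if_not_P)
    qed
    have "\<forall>\<^sub>F k in sequentially. l1_norm (Suc k) (u k) = 0"
      unfolding l1u by (rule eventually_sequentiallyI[of "Suc n"]) simp
    then show "(\<lambda>k. l1_norm (Suc k) (u k)) \<longlonglongrightarrow> 0" by (rule tendsto_eventually)
  qed
  have "norm (u n 0) = 1" by (simp add: u_def z_def r_def)
  then have ge: "1 \<le> B10_norm u" using norm_le_B10_norm[OF u, of n 0] by simp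
  have tele: "(\<Sum>j<Suc n. norm (tree_diff z j)) \<le> 2"
  proof -
    have "(\<Sum>j<Suc n. norm (tree_diff z j)) = norm (z 0) + (\<Sum>j<n. norm (tree_diff z (Suc j)))"
      by (subst sum.lessThan_Suc_shift) simp
    also have "\<dots> \<le> norm (z 0) + (\<Sum>j<n. r j - r (Suc j))" by (intro add_mono sum_mono pair order_refl)
    also have "\<dots> = norm (z 0) + (r 0 - r n)" by (simp only: sum_lessThan_telescope')
    also have "\<dots> \<le> 2" using r0[of n] by (simp add: z_def r_def)
    finally show ?thesis .
  qed
  have le: "B10_norm u \<le> 2"
  proof (rule B10_norm_least)
    show "l1_norm (Suc k) (u k) \<le> 2" for k unfolding l1u using tele by (cases "k = n") (simp_all del: sum.lessThan_Suc)
  qed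
  have coord0: "tree_coord k u = 0" if k: "triangle n + n < k" for k
  proof -
    obtain i d where kd: "prod_decode k = (i, d)" by (cases "prod_decode k")
    then have "k = triangle (i + d) + i" using prod_decode_inverse[of k] by (simp add: prod_encode_def)
    then have "i + d \<noteq> n" using k by fastforce
    then have "u (i + d) j = 0" for j by (simp add: u_def)
    moreover have "tree_diff (\<lambda>i. 0 :: 'f) j = 0" for j by (cases j) simp_all
    ultimately have "tree_sum (u (i + d)) i = 0" by (intro tree_sum_tree_diff) simp
    then show ?thesis by (simp add: tree_coord_def kd)
  qed
  define w where "w i = (if even i then z i else 0)" for i
  have proj: "tree_proj A u n j = tree_diff w j" if j: "j \<le> n" for j
  proof -
    have "tree_diff (\<lambda>i. if prod_encode (i, n - i) \<in> A then tree_sum (u n) i else 0) j = tree_diff w j"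
    proof (rule tree_diff_cong)
      fix i assume "i \<le> j"
      then have i: "i \<le> n" using j by simp
      have "tree_sum (u n) i = z i"
      proof (rule tree_sum_tree_diff)
        show "u n l = tree_diff z l" if "l \<le> i" for l using that i by (simp add: u_def)
      qed
      moreover have "prod_encode (i, n - i) \<in> A \<longleftrightarrow> even i"
        using i unfolding A_def by simp (simp add: prod_encode_def)
      ultimately show "(if prod_encode (i, n - i) \<in> A then tree_sum (u n) i else 0) = w i"
        by (simp add: w_def)
    qed
    then show ?thesis using j by (simp add: tree_proj_def)
  qed
  \<comment> \<open>Of four consecutive nodes only \<open>4 * q + 1\<close> is counted: it is odd
    and hence deleted, while its parent \<open>2 * q\<close> is kept. The entry left there has
    modulus \<open>1 / (4 * q + 2)\<close>, at least a quarter of \<open>1 / (q + 1)\<close> and so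
    of the increment of the logarithm.\<close>
  have low: "ln (real q + 1) / 4 \<le> (\<Sum>i<4 * q. norm (tree_diff w (Suc i)))" for q
  proof (induction q)
    case 0
    show ?case by simp
  next
    case (Suc q)
    have "tree_diff w (Suc (4 * q)) = - (z (2 * q) / 2)" by (simp add: w_def)
    then have "norm (tree_diff w (Suc (4 * q))) = norm (z (2 * q)) / 2"
      by (simp only: norm_minus_cancel norm_divide norm_numeral)
    also have "norm (z (2 * q)) = r (2 * q)"
      unfolding z_def norm_of_real using r0[of "2 * q"] by simp
    also have "r (2 * q) / 2 = 1 / (4 * real q + 2)" by (simp add: r_def field_simps)
    finally have t: "norm (tree_diff w (Suc (4 * q))) = 1 / (4 * real q + 2)" .
    have "1 + 1 / (real q + 1) = (real (Suc q) + 1) / (real q + 1)" by (simp add: field_simps)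
    then have "ln (real (Suc q) + 1) - ln (real q + 1) = ln (1 + 1 / (real q + 1))"
      by (simp add: ln_div)
    also have "\<dots> \<le> 1 / (real q + 1)" by (rule ln_add_one_self_le_self) simp
    also have "\<dots> \<le> 4 * (1 / (4 * real q + 2))" by (simp add: field_simps)
    finally have d: "ln (real (Suc q) + 1) / 4 \<le> ln (real q + 1) / 4 + 1 / (4 * real q + 2)" by simp
    have "(\<Sum>i<4 * q. norm (tree_diff w (Suc i))) + norm (tree_diff w (Suc (4 * q)))
      = (\<Sum>i<Suc (4 * q). norm (tree_diff w (Suc i)))" by simp
    also have "\<dots> \<le> (\<Sum>i<4 * Suc q. norm (tree_diff w (Suc i)))"
      by (rule sum_mono2) simp_all
    finally show ?case using Suc.IH d unfolding t by linarith
  qed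
  have fin: "finite A" unfolding A_def by simp
  have "ln (real m + 1) / 4 \<le> (\<Sum>i<n. norm (tree_diff w (Suc i)))"
    unfolding n_def by (rule low)
  also have "\<dots> \<le> norm (tree_diff w 0) + (\<Sum>i<n. norm (tree_diff w (Suc i)))" by simp
  also have "\<dots> = (\<Sum>i<Suc n. norm (tree_diff w i))" by (rule sum.lessThan_Suc_shift[symmetric])
  also have "\<dots> = l1_norm (Suc n) (tree_proj A u n)"
    unfolding l1_norm_def by (intro sum.cong) (simp_all add: proj)
  also have "\<dots> \<le> B10_norm (tree_proj A u)"
    by (intro B10_norm_upper tree_proj_carrier fin)
  finally have "ln (real m + 1) / 4 \<le> B10_norm (tree_proj A u)" .
  then show ?thesis using u fin ge le coord0 unfolding n_def by (intro bexI[of _ u] exI[of _ A]) simp_all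
qed

section \<open>Coordinates and greedy projections of a Schauder basis\<close>

text \<open>The weights are a mixture, of total mass at most \<open>W\<close>, of indicators of
  their superlevel sets, so bounds on the sums over these sets suffice. The induction peels off the
  lowest layer: after subtracting the least weight \<open>m\<close>, level \<open>s\<close> of the
  new weights is level \<open>s + m\<close> of the old ones.\<close>

lemma layer_cake:
  fixes v :: "'i \<Rightarrow> 'a::real_normed_vector"
  assumes "finite D" "\<And>j. j \<in> D \<Longrightarrow> 0 \<le> w j \<and> w j \<le> W" "0 \<le> W" "0 \<le> K"
    and "\<And>s. 0 < s \<Longrightarrow> norm (\<Sum>j | j \<in> D \<and> s \<le> w j. v j) \<le> K"
  shows "norm (\<Sum>j\<in>D. w j *\<^sub>R v j) \<le> W * K"
  using assms
proof (induction "card D" arbitrary: D w W rule: less_induct)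
  case less
  note fin = less.prems(1) and w = less.prems(2) and W = less.prems(3) and K = less.prems(4)
    and lev = less.prems(5)
  show ?case
  proof (cases "D = {}")
    case True
    then show ?thesis using W K by simp
  next
    case False
    define m where "m = Min (w ` D)"
    have "m \<in> w ` D" unfolding m_def using fin False by (intro Min_in) simp_all
    then obtain i where i: "i \<in> D" "m = w i" by (rule imageE)
    have m_le: "m \<le> w j" if "j \<in> D" for j unfolding m_def using fin that by (intro Min_le) simp_all
    define D' where "D' = {j \<in> D. m < w j}"
    have fin': "finite D'" unfolding D'_def using fin by simp
    have m0: "0 \<le> m" "m \<le> W" using w[OF i(1)] i(2) by simp_all
    have "D' \<subset> D" using i unfolding D'_def by blast
    then have card: "card D' < card D" using fin by (intro psubset_card_mono)
    have IH: "norm (\<Sum>j\<in>D'. (w j - m) *\<^sub>R v j) \<le> (W - m) * K"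
    proof (rule less.hyps[OF card fin' _ _ K])
      show "0 \<le> w j - m \<and> w j - m \<le> W - m" if "j \<in> D'" for j
        using that w[of j] by (simp add: D'_def)
      show "0 \<le> W - m" using m0 by simp
      show "norm (\<Sum>j | j \<in> D' \<and> s \<le> w j - m. v j) \<le> K" if s: "0 < s" for s
      proof -
        have "j \<in> D' \<and> s \<le> w j - m \<longleftrightarrow> j \<in> D \<and> s + m \<le> w j" for j
          using s by (simp add: D'_def) linarith
        then show ?thesis using lev[of "s + m"] s m0 by simp
      qed
    qed
    have "norm (m *\<^sub>R (\<Sum>j\<in>D. v j)) \<le> m * K"
    proof (cases "m = 0")
      case False
      then have "0 < m" using m0 by simp
      moreover have "{j. j \<in> D \<and> m \<le> w j} = D" using m_le by (simp add: set_eq_iff) blast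
      ultimately have "norm (\<Sum>j\<in>D. v j) \<le> K" using lev[of m] by simp
      then show ?thesis using m0 by (simp add: mult_left_mono)
    qed simp
    moreover have "(\<Sum>j\<in>D. w j *\<^sub>R v j) = m *\<^sub>R (\<Sum>j\<in>D. v j) + (\<Sum>j\<in>D'. (w j - m) *\<^sub>R v j)"
    proof -
      have "(\<Sum>j\<in>D'. (w j - m) *\<^sub>R v j) = (\<Sum>j\<in>D. (w j - m) *\<^sub>R v j)"
      proof (rule sum.mono_neutral_left[OF fin])
        show "D' \<subseteq> D" unfolding D'_def by simp
        show "\<forall>j\<in>D - D'. (w j - m) *\<^sub>R v j = 0" using m_le unfolding D'_def by fastforce
      qed
      then show ?thesis by (simp add: scaleR_diff_left sum_subtractf scaleR_sum_right)
    qed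
    ultimately show ?thesis
      using IH norm_triangle_ineq[of "m *\<^sub>R (\<Sum>j\<in>D. v j)" "\<Sum>j\<in>D'. (w j - m) *\<^sub>R v j"]
      by (simp add: left_diff_distrib)
  qed
qed

context banach_over
begin

text \<open>Continuity of \<open>c n\<close> yields uniqueness: on the partial sums of any expansion
  of \<open>x\<close> its value is eventually the constant \<open>a n\<close>, and in the limit it
  must be \<open>c n x\<close>.\<close>

lemma schauder_basis_coord:
  assumes c_add: "\<And>n x y. c n (x + y) = c n x + c n y"
    and c_scale: "\<And>n a x. c n (smul a x) = a * c n x"
    and c_bounded: "\<And>n. \<exists>K. \<forall>x. norm (c n x) \<le> K * norm x"
    and c_delta: "\<And>n m. c n (B m) = (if n = m then 1 else 0)"
    and expand: "\<And>x. (\<lambda>n. smul (c n x) (B n)) sums x"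
  shows "schauder_basis smul B" "coord smul B n x = c n x"
proof -
  have uniq: "a = (\<lambda>n. c n x)" if a: "(\<lambda>n. smul (a n) (B n)) sums x" for a x
  proof
    fix n
    obtain K where K: "\<And>x. norm (c n x) \<le> K * norm x" using c_bounded[of n] by blast
    have diff: "c n (x - y) = c n x - c n y" for x y
      using c_add[of n "x - y" y] by simp
    have c_sum: "c n (\<Sum>k<N. smul (a k) (B k)) = (if n < N then a n else 0)" for N
    proof (induction N)
      case 0
      show ?case using diff[of 0 0] by simp
    next
      case (Suc N)
      then show ?case by (simp add: c_add c_scale c_delta less_Suc_eq)
    qed
    have lim: "(\<lambda>N. K * norm ((\<Sum>k<N. smul (a k) (B k)) - x)) \<longlonglongrightarrow> 0"
      using a unfolding sums_def by (intro tendsto_mult_right_zero tendsto_norm_zero) (simp add: LIM_zero_iff)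
    have "(\<lambda>N. c n ((\<Sum>k<N. smul (a k) (B k)) - x)) \<longlonglongrightarrow> 0"
      by (rule Lim_null_comparison[OF always_eventually lim]) (simp add: K)
    then have l1: "(\<lambda>N. c n (\<Sum>k<N. smul (a k) (B k))) \<longlonglongrightarrow> c n x"
      unfolding diff by (simp add: LIM_zero_iff)
    have "(\<lambda>N. c n (\<Sum>k<N. smul (a k) (B k))) \<longlonglongrightarrow> a n"
      by (rule tendsto_eventually, rule eventually_sequentiallyI[of "Suc n"]) (simp add: c_sum)
    from LIMSEQ_unique[OF this l1] show "a n = c n x" .
  qed
  show "schauder_basis smul B"
    unfolding schauder_basis_def using expand uniq by (intro allI ex1I)
  have "(THE a. (\<lambda>k. smul (a k) (B k)) sums x) = (\<lambda>n. c n x)"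
    by (rule the_equality) (rule expand, rule uniq)
  then show "coord smul B n x = c n x" unfolding coord_def by simp
qed

lemma coord_sums:
  assumes "schauder_basis smul B"
  shows "(\<lambda>n. smul (coord smul B n f) (B n)) sums f"
proof -
  have "\<exists>!a. (\<lambda>n. smul (a n) (B n)) sums f" using assms unfolding schauder_basis_def by blast
  from theI'[OF this] show ?thesis unfolding coord_def .
qed

lemma coord_eqI:
  assumes "schauder_basis smul B" "(\<lambda>n. smul (a n) (B n)) sums f"
  shows "coord smul B n f = a n"
proof -
  have "\<exists>!a. (\<lambda>n. smul (a n) (B n)) sums f" using assms(1) unfolding schauder_basis_def by blast
  then have "(THE a. (\<lambda>n. smul (a n) (B n)) sums f) = a" using assms(2)
    by (rule the1_equality[where P = "\<lambda>a. (\<lambda>n. smul (a n) (B n)) sums f"])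
  then show ?thesis unfolding coord_def by simp
qed

lemma coord_add:
  assumes "schauder_basis smul B"
  shows "coord smul B n (f + g) = coord smul B n f + coord smul B n g"
  using sums_add[OF coord_sums[OF assms, of f] coord_sums[OF assms, of g]]
  by (intro coord_eqI[OF assms]) (simp add: scale_left_distrib)

lemma bounded_linear_smul: "bounded_linear (smul a)"
  by (rule bounded_linear_intro[where K = "norm a"])
    (simp_all add: scale_right_distrib norm_smul mult.commute scale_scale flip: smul_of_real)

lemma coord_scale:
  assumes "schauder_basis smul B"
  shows "coord smul B n (smul a f) = a * coord smul B n f"
  using bounded_linear.sums[OF bounded_linear_smul coord_sums[OF assms, of f], of a]
  by (intro coord_eqI[OF assms]) (simp add: scale_scale)

lemma coord_sum:
  assumes "schauder_basis smul B" "finite D"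
  shows "coord smul B n (\<Sum>j\<in>D. smul (a j) (B j)) = (if n \<in> D then a n else 0)"
proof -
  have "(\<lambda>n. if n \<in> D then smul (a n) (B n) else 0) sums (\<Sum>j\<in>D. smul (a j) (B j))"
    using assms(2) by (rule sums_If_finite_set)
  moreover have "(\<lambda>n. if n \<in> D then smul (a n) (B n) else 0) = (\<lambda>n. smul (if n \<in> D then a n else 0) (B n))"
    by (rule ext) simp
  ultimately show ?thesis by (intro coord_eqI[OF assms(1)]) simp
qed

lemma coord_basis:
  assumes "schauder_basis smul B"
  shows "coord smul B n (B m) = (if n = m then 1 else 0)"
  using coord_sum[OF assms, of "{m}" n "\<lambda>_. 1"] by simp

lemma coord_proj_finite:
  assumes "finite A"
  shows "coord_proj smul B A f = (\<Sum>n\<in>A. smul (coord smul B n f) (B n))"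
  unfolding coord_proj_def by (rule sums_unique[symmetric], rule sums_If_finite_set, rule assms)

lemma coord_proj_finite_supp:
  assumes "finite D" "supp smul B f \<subseteq> D"
  shows "coord_proj smul B A f = (\<Sum>n\<in>A \<inter> D. smul (coord smul B n f) (B n))"
proof -
  have "(\<lambda>n. if n \<in> A then smul (coord smul B n f) (B n) else 0)
      = (\<lambda>n. if n \<in> A \<inter> D then smul (coord smul B n f) (B n) else 0)"
  proof
    show "(if n \<in> A then smul (coord smul B n f) (B n) else 0)
      = (if n \<in> A \<inter> D then smul (coord smul B n f) (B n) else 0)" for n
    proof (cases "n \<in> D")
      case False
      then have "coord smul B n f = 0" using assms(2) by (simp add: supp_def) blast
      then show ?thesis by simp
    qed simp
  qed
  then show ?thesis unfolding coord_proj_def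
    using sums_If_finite_set[of "A \<inter> D" "\<lambda>n. smul (coord smul B n f) (B n)"] assms(1)
    by (simp add: sums_iff)
qed

lemma coord_proj_supp:
  assumes "schauder_basis smul B" "supp smul B f \<subseteq> A"
  shows "coord_proj smul B A f = f"
proof -
  have "(\<lambda>n. if n \<in> A then smul (coord smul B n f) (B n) else 0) = (\<lambda>n. smul (coord smul B n f) (B n))"
  proof
    show "(if n \<in> A then smul (coord smul B n f) (B n) else 0) = smul (coord smul B n f) (B n)" for n
      using assms(2) by (cases "coord smul B n f = 0") (simp_all add: supp_def subset_iff)
  qed
  then show ?thesis
    unfolding coord_proj_def using sums_unique[OF coord_sums[OF assms(1), of f]] by simp
qed

definition greedy_set :: "(nat \<Rightarrow> 'x) \<Rightarrow> 'x \<Rightarrow> nat set \<Rightarrow> bool" where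
  "greedy_set B f A \<longleftrightarrow>
     (\<forall>j k. j \<notin> A \<longrightarrow> k \<in> A \<longrightarrow> norm (coord smul B j f) \<le> norm (coord smul B k f))"

lemma coord_tendsto_zero:
  assumes B: "schauder_basis smul B" and d: "0 < \<delta>" "\<And>n. \<delta> \<le> norm (B n)"
  shows "(\<lambda>n. coord smul B n f) \<longlonglongrightarrow> 0"
proof -
  have "(\<lambda>n. smul (coord smul B n f) (B n)) \<longlonglongrightarrow> 0"
    using coord_sums[OF B] by (intro summable_LIMSEQ_zero sums_summable)
  then have lim: "(\<lambda>n. norm (smul (coord smul B n f) (B n)) / \<delta>) \<longlonglongrightarrow> 0"
    using tendsto_divide[OF tendsto_norm_zero tendsto_const, of _ sequentially \<delta>] d(1) by simp
  show ?thesis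
  proof (rule Lim_null_comparison[OF always_eventually lim], rule allI)
    fix n
    have "norm (coord smul B n f) * \<delta> \<le> norm (coord smul B n f) * norm (B n)"
      using d(2) by (intro mult_left_mono) simp_all
    then show "norm (coord smul B n f) \<le> norm (smul (coord smul B n f) (B n)) / \<delta>"
      using d(1) by (simp add: norm_smul field_simps)
  qed
qed

lemma finite_coord_ge:
  assumes "(\<lambda>n. coord smul B n f) \<longlonglongrightarrow> 0" "0 < t"
  shows "finite {n. t \<le> norm (coord smul B n f)}"
proof -
  obtain N where "\<And>n. N \<le> n \<Longrightarrow> norm (coord smul B n f - 0) < t"
    using LIMSEQ_D[OF assms] by blast
  then have N: "norm (coord smul B n f) < t" if "N \<le> n" for n using that by simp
  have "n < N" if "t \<le> norm (coord smul B n f)" for n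
    using N[of n] that by (cases "N \<le> n") simp_all
  then have "{n. t \<le> norm (coord smul B n f)} \<subseteq> {..<N}" by (simp add: subset_iff)
  then show ?thesis by (rule finite_subset) simp
qed

text \<open>A nonzero coordinate outside \<open>A\<close> would be a positive lower bound for the
  moduli of all coordinates in \<open>A\<close>, and only finitely many terms of a null sequence
  obey one. So infinite greedy sets reproduce \<open>f\<close>, and estimates need to treat finite
  ones only.\<close>

lemma greedy_set_finite_or_supp:
  assumes lim: "(\<lambda>n. coord smul B n f) \<longlonglongrightarrow> 0" and gr: "greedy_set B f A"
  shows "finite A \<or> supp smul B f \<subseteq> A"
proof (rule ccontr)
  assume "\<not> ?thesis"
  then obtain j where inf: "infinite A" and j: "coord smul B j f \<noteq> 0" "j \<notin> A"
    unfolding supp_def by blast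
  have "A \<subseteq> {n. norm (coord smul B j f) \<le> norm (coord smul B n f)}"
    using gr j(2) unfolding greedy_set_def by blast
  moreover have "finite {n. norm (coord smul B j f) \<le> norm (coord smul B n f)}"
    using j(1) by (intro finite_coord_ge lim) simp
  ultimately show False using inf finite_subset by blast
qed

lemma greedy_bound_finite:
  assumes B: "schauder_basis smul B" and lim: "(\<lambda>n. coord smul B n f) \<longlonglongrightarrow> 0"
    and fin: "\<And>A. finite A \<Longrightarrow> greedy_set B f A \<Longrightarrow>
       norm (f - (\<Sum>n\<in>A. smul (coord smul B n f) (B n))) \<le> C * norm f"
    and C: "0 \<le> C" and A: "greedy_set B f A"
  shows "norm (f - coord_proj smul B A f) \<le> C * norm f"
proof (cases "finite A")
  case True
  then show ?thesis using fin[OF True A] by (simp add: coord_proj_finite)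
next
  case False
  then have "supp smul B f \<subseteq> A" using greedy_set_finite_or_supp[OF lim A] by blast
  then show ?thesis using C by (simp add: coord_proj_supp[OF B])
qed

lemma quasi_greedy_basisE:
  assumes "quasi_greedy_basis smul B"
  obtains C \<delta> \<beta> where "schauder_basis smul B" "0 < C" "0 < \<delta>"
    "\<And>n. \<delta> \<le> norm (B n)" "\<And>n. norm (B n) \<le> \<beta>"
    "\<And>f A. greedy_set B f A \<Longrightarrow> norm (f - coord_proj smul B A f) \<le> C * norm f"
proof -
  note conj = assms[unfolded quasi_greedy_basis_def, folded greedy_set_def]
  have B: "schauder_basis smul B" "0 < (INF j. norm (B j))" "bdd_above (range (\<lambda>j. norm (B j)))"
    "\<exists>C. \<forall>f A. greedy_set B f A \<longrightarrow> norm (f - coord_proj smul B A f) \<le> C * norm f"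
    by (rule conj[THEN conjunct1] conj[THEN conjunct2, THEN conjunct1]
      conj[THEN conjunct2, THEN conjunct2, THEN conjunct1]
      conj[THEN conjunct2, THEN conjunct2, THEN conjunct2])+
  from B(4) obtain C where C: "\<And>f A. greedy_set B f A \<Longrightarrow> norm (f - coord_proj smul B A f) \<le> C * norm f"
    by blast
  from B(3) obtain \<beta> where \<beta>: "\<And>n. norm (B n) \<le> \<beta>" unfolding bdd_above_def by blast
  have "bdd_below (range (\<lambda>j. norm (B j)))" by (rule bdd_belowI2[of _ 0]) simp
  then have low: "(INF j. norm (B j)) \<le> norm (B n)" for n by (intro cINF_lower) simp_all
  have "norm (f - coord_proj smul B A f) \<le> max C 1 * norm f" if "greedy_set B f A" for f A
    using C[OF that] by (rule order_trans) (simp add: mult_right_mono)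
  then show ?thesis by (intro that[of "max C 1" "INF j. norm (B j)" \<beta>] B(1,2) \<beta> low) simp_all
qed

section \<open>The logarithmic upper bound for quasi-greedy bases\<close>

text \<open>If all coefficients have the same modulus, every set of indices in the support is greedy; the general case is
  reduced to this one by two applications of the layer-cake bound that remove and restore the moduli.\<close>

lemma norm_level_proj_le:
  assumes B: "schauder_basis smul B" and C: "0 < C"
    and greedy: "\<And>f A. greedy_set B f A \<Longrightarrow> norm (f - coord_proj smul B A f) \<le> C * norm f"
    and D: "finite D" "E \<subseteq> D" and t: "0 < t"
    and a: "\<And>j. j \<in> D \<Longrightarrow> t \<le> norm (a j)" "\<And>j. j \<in> D \<Longrightarrow> norm (a j) \<le> 2 * t"
  shows "norm (\<Sum>j\<in>E. smul (a j) (B j)) \<le> 2 * C\<^sup>2 * norm (\<Sum>j\<in>D. smul (a j) (B j))"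
proof -
  define g where "g = (\<Sum>j\<in>D. smul (a j) (B j))"
  define \<epsilon> where "\<epsilon> j = of_real (1 / norm (a j)) * a j" for j
  define e where "e = (\<Sum>j\<in>D. smul (\<epsilon> j) (B j))"
  have a0: "0 < norm (a j)" if "j \<in> D" for j using a(1)[OF that] t by linarith
  have \<epsilon>1: "norm (\<epsilon> j) = 1" if "j \<in> D" for j
    using a0[OF that] by (simp add: \<epsilon>_def norm_mult norm_divide)
  have "norm (\<Sum>j\<in>D. (1 / norm (a j)) *\<^sub>R smul (a j) (B j)) \<le> 1 / t * (C * norm g)"
  proof (rule layer_cake[OF D(1)])
    show "0 \<le> 1 / norm (a j) \<and> 1 / norm (a j) \<le> 1 / t" if "j \<in> D" for j
      using a(1)[OF that] t by (simp add: frac_le)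
    show "0 \<le> 1 / t" "0 \<le> C * norm g" using t C by simp_all
    fix s :: real assume s: "0 < s"
    \<comment> \<open>The weights \<open>1 / norm (a j)\<close> reverse the order of the moduli:
      their superlevel set is what remains of \<open>D\<close> when the greedy set \<open>A\<close>
      is removed.\<close>
    define A where "A = {j \<in> D. \<not> s \<le> 1 / norm (a j)}"
    have finA: "finite A" unfolding A_def using D(1) by simp
    have cg: "coord smul B j g = (if j \<in> D then a j else 0)" for j
      unfolding g_def by (rule coord_sum[OF B D(1)])
    have "greedy_set B g A"
      unfolding greedy_set_def
    proof (intro allI impI)
      fix j k assume jk: "j \<notin> A" "k \<in> A"
      then have k: "k \<in> D" "1 / norm (a k) < s" by (simp_all add: A_def)
      show "norm (coord smul B j g) \<le> norm (coord smul B k g)"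
      proof (cases "j \<in> D")
        case True
        then have "s \<le> 1 / norm (a j)" using jk(1) by (simp add: A_def)
        then have "1 / norm (a k) < 1 / norm (a j)" using k(2) by linarith
        then show ?thesis using True k(1) a0[OF True] a0[OF k(1)] by (simp add: cg field_simps)
      qed (simp add: cg)
    qed
    from greedy[OF this] have le: "norm (g - (\<Sum>n\<in>A. smul (coord smul B n g) (B n))) \<le> C * norm g"
      by (simp add: coord_proj_finite[OF finA])
    have "(\<Sum>n\<in>A. smul (coord smul B n g) (B n)) = (\<Sum>n\<in>A. smul (a n) (B n))"
      by (rule sum.cong) (simp_all add: cg A_def)
    moreover have "g = (\<Sum>n\<in>A. smul (a n) (B n)) + (\<Sum>n | n \<in> D \<and> s \<le> 1 / norm (a n). smul (a n) (B n))"
      unfolding g_def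
    proof -
      have AD: "A \<subseteq> D" unfolding A_def by blast
      have "D - A = {n. n \<in> D \<and> s \<le> 1 / norm (a n)}" unfolding A_def by blast
      then show "(\<Sum>j\<in>D. smul (a j) (B j))
        = (\<Sum>n\<in>A. smul (a n) (B n)) + (\<Sum>n | n \<in> D \<and> s \<le> 1 / norm (a n). smul (a n) (B n))"
        using sum.subset_diff[OF AD D(1), of "\<lambda>n. smul (a n) (B n)"] by (simp only: add.commute)
    qed
    ultimately show "norm (\<Sum>j | j \<in> D \<and> s \<le> 1 / norm (a j). smul (a j) (B j)) \<le> C * norm g"
      using le by simp
  qed
  then have e_le: "norm e \<le> C * norm g / t"
    by (simp add: e_def \<epsilon>_def scale_scale flip: smul_of_real)
  have sub: "norm (\<Sum>j\<in>F. smul (\<epsilon> j) (B j)) \<le> C * norm e" if F: "F \<subseteq> D" for F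
  proof -
    have fin: "finite (D - F)" using D(1) by simp
    have ce: "coord smul B j e = (if j \<in> D then \<epsilon> j else 0)" for j
      unfolding e_def by (rule coord_sum[OF B D(1)])
    have "greedy_set B e (D - F)"
      unfolding greedy_set_def by (simp add: ce \<epsilon>1)
    from greedy[OF this] have le: "norm (e - (\<Sum>n\<in>D - F. smul (coord smul B n e) (B n))) \<le> C * norm e"
      by (simp add: coord_proj_finite[OF fin])
    have "(\<Sum>n\<in>D - F. smul (coord smul B n e) (B n)) = (\<Sum>n\<in>D - F. smul (\<epsilon> n) (B n))"
      by (rule sum.cong) (simp_all add: ce)
    moreover have "e = (\<Sum>n\<in>D - F. smul (\<epsilon> n) (B n)) + (\<Sum>n\<in>F. smul (\<epsilon> n) (B n))"
      unfolding e_def using sum.subset_diff[OF F D(1)] .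
    ultimately show ?thesis using le by simp
  qed
  \<comment> \<open>Normalizing cost the factor \<open>1 / t\<close> and restoring the moduli costs
    \<open>2 * t\<close>, so the scale cancels and \<open>2 * C\<^sup>2\<close> remains.\<close>
  have "norm (\<Sum>j\<in>E. norm (a j) *\<^sub>R smul (\<epsilon> j) (B j)) \<le> 2 * t * (C * norm e)"
  proof (rule layer_cake)
    show "finite E" using D by (rule finite_subset[rotated])
    show "0 \<le> norm (a j) \<and> norm (a j) \<le> 2 * t" if "j \<in> E" for j using a(2)[of j] that D(2) by (simp add: subset_iff)
    show "0 \<le> 2 * t" "0 \<le> C * norm e" using t C by simp_all
    show "norm (\<Sum>j | j \<in> E \<and> s \<le> norm (a j). smul (\<epsilon> j) (B j)) \<le> C * norm e" for s
    proof (rule sub)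
      show "{j. j \<in> E \<and> s \<le> norm (a j)} \<subseteq> D" using D(2) by blast
    qed
  qed
  also have "(\<Sum>j\<in>E. norm (a j) *\<^sub>R smul (\<epsilon> j) (B j)) = (\<Sum>j\<in>E. smul (a j) (B j))"
  proof (rule sum.cong[OF refl])
    fix j assume "j \<in> E"
    then have "0 < norm (a j)" using D(2) a0[of j] by blast
    moreover have "norm (a j) *\<^sub>R smul (\<epsilon> j) (B j) = smul (of_real (norm (a j)) * \<epsilon> j) (B j)"
      by (simp add: scale_scale flip: smul_of_real)
    moreover have "of_real (norm (a j)) * \<epsilon> j = of_real (norm (a j) * (1 / norm (a j))) * a j"
      unfolding \<epsilon>_def of_real_mult mult.assoc ..
    ultimately show "norm (a j) *\<^sub>R smul (\<epsilon> j) (B j) = smul (a j) (B j)" by simp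
  qed
  also have "2 * t * (C * norm e) \<le> 2 * t * (C * (C * norm g / t))"
    using t C e_le by (intro mult_left_mono) simp_all
  also have "\<dots> = 2 * C\<^sup>2 * norm g" using t by (simp add: power2_eq_square)
  finally show ?thesis unfolding g_def .
qed

text \<open>A single term of the expansion is the difference of two greedy projections: onto all
  coordinates at least as large as the one at \<open>j\<close>, with and without \<open>j\<close>
  itself. This gives continuity of the coordinates, uniformly in \<open>j\<close>, without a closed
  graph argument.\<close>

lemma coord_bounded:
  assumes B: "schauder_basis smul B" and \<delta>: "0 < \<delta>" "\<And>n. \<delta> \<le> norm (B n)"
    and greedy: "\<And>f A. greedy_set B f A \<Longrightarrow> norm (f - coord_proj smul B A f) \<le> C * norm f"
  shows "norm (coord smul B j f) \<le> 2 * C / \<delta> * norm f"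
proof (cases "coord smul B j f = 0")
  case True
  have "greedy_set B f {}" by (simp add: greedy_set_def)
  from greedy[OF this] have "0 \<le> C * norm f" using norm_ge_zero order_trans by blast
  then show ?thesis using True \<delta>(1) by simp
next
  case False
  define A where "A = {k. norm (coord smul B j f) \<le> norm (coord smul B k f)}"
  have fin: "finite A" unfolding A_def
    using False by (intro finite_coord_ge coord_tendsto_zero[OF B \<delta>]) simp
  have g1: "greedy_set B f A" unfolding greedy_set_def A_def by (simp add: not_le)
  have g2: "greedy_set B f (A - {j})"
    unfolding greedy_set_def
  proof (intro allI impI)
    fix i k assume ik: "i \<notin> A - {j}" "k \<in> A - {j}"
    show "norm (coord smul B i f) \<le> norm (coord smul B k f)"
      using ik by (cases "i = j") (simp_all add: A_def)
  qed
  have j: "j \<in> A" by (simp add: A_def)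
  have eq: "(f - coord_proj smul B (A - {j}) f) - (f - coord_proj smul B A f) = smul (coord smul B j f) (B j)"
    using fin sum.remove[OF fin j, of "\<lambda>n. smul (coord smul B n f) (B n)"]
    by (simp add: coord_proj_finite)
  have "norm (coord smul B j f) * \<delta> \<le> norm (coord smul B j f) * norm (B j)"
    by (rule mult_left_mono[OF \<delta>(2)]) simp
  also have "\<dots> \<le> norm (f - coord_proj smul B (A - {j}) f) + norm (f - coord_proj smul B A f)"
    using norm_triangle_ineq4[of "f - coord_proj smul B (A - {j}) f" "f - coord_proj smul B A f"]
    unfolding eq norm_smul .
  also have "\<dots> \<le> 2 * C * norm f" using greedy[OF g1] greedy[OF g2] by simp
  finally show ?thesis using \<delta>(1) by (simp add: field_simps)
qed

lemma norm_coord_proj_le_ln: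
  assumes "quasi_greedy_basis smul B"
  obtains K where "\<And>m f A. 2 \<le> m \<Longrightarrow> supp smul B f \<subseteq> {..<m} \<Longrightarrow>
    norm (coord_proj smul B A f) \<le> K * ln (real m) * norm f"
proof -
  obtain C \<delta> \<beta> where B: "schauder_basis smul B" and C: "0 < C" and \<delta>: "0 < \<delta>" "\<And>n. \<delta> \<le> norm (B n)"
    and \<beta>: "\<And>n. norm (B n) \<le> \<beta>"
    and greedy: "\<And>f A. greedy_set B f A \<Longrightarrow> norm (f - coord_proj smul B A f) \<le> C * norm f"
    using quasi_greedy_basisE[OF assms] by blast
  have \<beta>0: "0 \<le> \<beta>" using \<beta>[of 0] norm_ge_zero order_trans by blast
  \<comment> \<open>At most \<open>2 * log 2 m\<close> dyadic shells cost \<open>4 * C ^ 3\<close>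
    each, the coefficients below the last threshold cost \<open>2 * C * \<beta> / \<delta>\<close>,
    and \<open>ln 2\<close> converts the logarithm.\<close>
  define K where "K = (8 * C ^ 3 + 2 * C * \<beta> / \<delta>) / ln 2"
  show thesis
  proof (rule that[of K])
    fix m :: nat and f A
    assume m: "2 \<le> m" and supp: "supp smul B f \<subseteq> {..<m}"
    define a where "a j = coord smul B j f" for j
    define M where "M = 2 * C / \<delta> * norm f"
    have a_le: "norm (a j) \<le> M" for j
      unfolding a_def M_def by (rule coord_bounded[OF B \<delta> greedy])
    have proj: "coord_proj smul B A f = (\<Sum>j\<in>A \<inter> {..<m}. smul (a j) (B j))"
      unfolding a_def by (rule coord_proj_finite_supp[OF _ supp]) simp
    show "norm (coord_proj smul B A f) \<le> K * ln (real m) * norm f"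
    proof (cases "f = 0")
      case True
      then have "a j = 0" for j using a_le[of j] by (simp add: M_def)
      then show ?thesis using True unfolding proj by simp
    next
      case False
      have M: "0 < M" using False C \<delta>(1) by (simp add: M_def)
      \<comment> \<open>The coordinates above a threshold form a greedy set; the strict inequality
        makes \<open>G 0\<close> empty, as \<open>M\<close> bounds all moduli.\<close>
      define G where "G N = {j \<in> {..<m}. M / 2 ^ N < norm (a j)}" for N
      have finG: "finite (G N)" for N by (simp add: G_def)
      have "greedy_set B f (G N)" for N
        unfolding greedy_set_def
      proof (intro allI impI)
        fix j k assume jk: "j \<notin> G N" "k \<in> G N"
        show "norm (coord smul B j f) \<le> norm (coord smul B k f)"
        proof (cases "j < m")
          case True
          then show ?thesis using jk by (simp add: G_def a_def)
        next
          case False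
          then have "coord smul B j f = 0" using supp unfolding supp_def by blast
          then show ?thesis by simp
        qed
      qed
      then have Gle: "norm (f - (\<Sum>j\<in>G N. smul (a j) (B j))) \<le> C * norm f" for N
        unfolding a_def using greedy[of f "G N"] by (simp add: coord_proj_finite[OF finG])
      have levels: "norm (\<Sum>j\<in>A \<inter> G N. smul (a j) (B j)) \<le> real N * (4 * C ^ 3 * norm f)" for N
      proof (induction N)
        case 0
        have "G 0 = {}" using a_le by (simp add: G_def not_less)
        then show ?case by simp
      next
        case (Suc N)
        have half: "M / 2 ^ Suc N \<le> M / 2 ^ N" using M by (simp add: field_simps)
        have sub: "G N \<subseteq> G (Suc N)" using half unfolding G_def by fastforce
        \<comment> \<open>A shell is the difference of two greedy projections, which costs
          \<open>2 * C\<close>. Inside it the moduli differ by a factor of at most 2, and an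
          arbitrary part of it costs another \<open>2 * C\<^sup>2\<close>.\<close>
        define D where "D = G (Suc N) - G N"
        have finD: "finite D" using finG by (simp add: D_def)
        have split: "(\<Sum>j\<in>G (Suc N). smul (a j) (B j)) = (\<Sum>j\<in>D. smul (a j) (B j)) + (\<Sum>j\<in>G N. smul (a j) (B j))"
          unfolding D_def by (rule sum.subset_diff[OF sub finG])
        have "norm (\<Sum>j\<in>D. smul (a j) (B j))
          = norm ((f - (\<Sum>j\<in>G N. smul (a j) (B j))) - (f - (\<Sum>j\<in>G (Suc N). smul (a j) (B j))))"
          unfolding split by (simp add: algebra_simps)
        also have "\<dots> \<le> C * norm f + C * norm f"
          by (rule order_trans[OF norm_triangle_ineq4 add_mono[OF Gle Gle]])
        finally have D_le: "norm (\<Sum>j\<in>D. smul (a j) (B j)) \<le> 2 * C * norm f" by simp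
        have "norm (\<Sum>j\<in>A \<inter> D. smul (a j) (B j)) \<le> 2 * C\<^sup>2 * norm (\<Sum>j\<in>D. smul (a j) (B j))"
        proof (rule norm_level_proj_le[OF B C greedy finD, where t = "M / 2 ^ Suc N"])
          show "0 < M / 2 ^ Suc N" using M by simp
          show "M / 2 ^ Suc N \<le> norm (a j)" if "j \<in> D" for j using that by (simp add: D_def G_def)
          show "norm (a j) \<le> 2 * (M / 2 ^ Suc N)" if "j \<in> D" for j using that by (auto simp: D_def G_def not_less)
        qed (assumption, rule Int_lower2)
        also have "\<dots> \<le> 2 * C\<^sup>2 * (2 * C * norm f)" using D_le by (intro mult_left_mono) simp_all
        also have "\<dots> = 4 * C ^ 3 * norm f" by (simp add: power2_eq_square power3_eq_cube)
        finally have AD: "norm (\<Sum>j\<in>A \<inter> D. smul (a j) (B j)) \<le> 4 * C ^ 3 * norm f" .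
        have "A \<inter> G (Suc N) = (A \<inter> D) \<union> (A \<inter> G N)" using sub unfolding D_def by blast
        then have "(\<Sum>j\<in>A \<inter> G (Suc N). smul (a j) (B j))
          = (\<Sum>j\<in>A \<inter> D. smul (a j) (B j)) + (\<Sum>j\<in>A \<inter> G N. smul (a j) (B j))"
        proof (simp only:, intro sum.union_disjoint)
          show "finite (A \<inter> D)" "finite (A \<inter> G N)" using finD finG by simp_all
          show "(A \<inter> D) \<inter> (A \<inter> G N) = {}" unfolding D_def by blast
        qed
        then have "norm (\<Sum>j\<in>A \<inter> G (Suc N). smul (a j) (B j))
          \<le> 4 * C ^ 3 * norm f + real N * (4 * C ^ 3 * norm f)"
          using norm_triangle_mono[OF AD Suc.IH] by (simp only:)
        then show ?case by (simp add: algebra_simps)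
      qed
      \<comment> \<open>As \<open>2 ^ N\<close> is at least \<open>m\<close>, the at most
        \<open>m\<close> remaining coefficients of modulus at most \<open>M / 2 ^ N\<close>
        contribute no more than \<open>M * \<beta>\<close>. For \<open>m \<ge> 2\<close> the
        logarithm to base 2 is at least 1, which absorbs both this tail and the rounding in
        \<open>N\<close>.\<close>
      define N where "N = nat \<lceil>log 2 (real m)\<rceil>"
      have log1: "1 \<le> log 2 (real m)" using m by (simp add: le_log_iff)
      have N1: "log 2 (real m) \<le> real N" unfolding N_def by (rule real_nat_ceiling_ge)
      have N2: "real N \<le> 2 * log 2 (real m)"
        using log1 unfolding N_def by linarith
      have mN: "real m \<le> 2 ^ N" using N1 m by (simp add: log_le_iff powr_realpow)
      have tail: "norm (\<Sum>j\<in>A \<inter> ({..<m} - G N). smul (a j) (B j)) \<le> M * \<beta>"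
      proof -
        have "norm (\<Sum>j\<in>A \<inter> ({..<m} - G N). smul (a j) (B j)) \<le> (\<Sum>j\<in>A \<inter> ({..<m} - G N). M / 2 ^ N * \<beta>)"
        proof (rule sum_norm_le)
          fix j assume "j \<in> A \<inter> ({..<m} - G N)"
          then have "norm (a j) \<le> M / 2 ^ N" by (auto simp: G_def not_less)
          then show "norm (smul (a j) (B j)) \<le> M / 2 ^ N * \<beta>"
            unfolding norm_smul using M by (intro mult_mono \<beta>) simp_all
        qed
        also have "\<dots> = real (card (A \<inter> ({..<m} - G N))) * (M / 2 ^ N * \<beta>)" by simp
        also have "\<dots> \<le> 2 ^ N * (M / 2 ^ N * \<beta>)"
        proof (rule mult_right_mono)
          have "card (A \<inter> ({..<m} - G N)) \<le> card {..<m}" by (intro card_mono) (simp, blast)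
          then show "real (card (A \<inter> ({..<m} - G N))) \<le> 2 ^ N" using mN by simp
          show "0 \<le> M / 2 ^ N * \<beta>" using M \<beta>0 by simp
        qed
        finally show ?thesis by simp
      qed
      have "A \<inter> {..<m} = (A \<inter> G N) \<union> (A \<inter> ({..<m} - G N))"
        unfolding G_def by blast
      then have "coord_proj smul B A f = (\<Sum>j\<in>A \<inter> G N. smul (a j) (B j)) + (\<Sum>j\<in>A \<inter> ({..<m} - G N). smul (a j) (B j))"
        unfolding proj
      proof (simp only:, intro sum.union_disjoint)
        show "finite (A \<inter> G N)" "finite (A \<inter> ({..<m} - G N))" using finG by simp_all
        show "(A \<inter> G N) \<inter> (A \<inter> ({..<m} - G N)) = {}" by blast
      qed
      then have "norm (coord_proj smul B A f) \<le> real N * (4 * C ^ 3 * norm f) + M * \<beta>"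
        using norm_triangle_mono[OF levels[of N] tail] by (simp only:)
      also have "\<dots> \<le> (2 * log 2 (real m)) * (4 * C ^ 3 * norm f) + log 2 (real m) * (M * \<beta>)"
      proof (rule add_mono)
        show "real N * (4 * C ^ 3 * norm f) \<le> (2 * log 2 (real m)) * (4 * C ^ 3 * norm f)"
          using N2 C by (intro mult_right_mono) simp_all
        show "M * \<beta> \<le> log 2 (real m) * (M * \<beta>)"
          using mult_right_mono[OF log1, of "M * \<beta>"] M \<beta>0 by simp
      qed
      also have "\<dots> = K * ln (real m) * norm f"
        by (simp add: K_def M_def log_def field_simps)
      finally show ?thesis .
    qed
  qed
qed

end

section \<open>The interleaved basis\<close>

text \<open>The space is isomorphic, through \<open>\<Phi>\<close> and \<open>\<Theta>\<close>, to its direct sum with the \<open>c\<^sub>0\<close>-sum of the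
  \<open>\<ell>\<^sub>1\<^sup>n\<close>; the inverse isomorphism is \<open>x \<mapsto> (\<Psi> x, R x)\<close>.\<close>

locale B10_summand = banach_over smul
  for smul :: "'f::{real_normed_field,euclidean_space} \<Rightarrow> 'x::banach \<Rightarrow> 'x" +
  fixes \<Phi> \<Psi> :: "'x \<Rightarrow> 'x" and \<Theta> :: "(nat \<Rightarrow> nat \<Rightarrow> 'f) \<Rightarrow> 'x"
    and R :: "'x \<Rightarrow> nat \<Rightarrow> nat \<Rightarrow> 'f" and K :: real
  assumes K_pos: "0 < K"
    and \<Phi>_add: "\<Phi> (x + y) = \<Phi> x + \<Phi> y" and \<Phi>_scale: "\<Phi> (smul a x) = smul a (\<Phi> x)"
    and norm_\<Phi>: "norm (\<Phi> x) \<le> K * norm x"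
    and \<Psi>_add: "\<Psi> (x + y) = \<Psi> x + \<Psi> y" and \<Psi>_scale: "\<Psi> (smul a x) = smul a (\<Psi> x)"
    and norm_\<Psi>: "norm (\<Psi> x) \<le> K * norm x"
    and \<Theta>_add: "u \<in> B10_carrier \<Longrightarrow> v \<in> B10_carrier \<Longrightarrow> \<Theta> (\<lambda>n i. u n i + v n i) = \<Theta> u + \<Theta> v"
    and \<Theta>_scale: "u \<in> B10_carrier \<Longrightarrow> \<Theta> (\<lambda>n i. a * u n i) = smul a (\<Theta> u)"
    and norm_\<Theta>: "u \<in> B10_carrier \<Longrightarrow> norm (\<Theta> u) \<le> K * B10_norm u"
    and R_carrier: "R x \<in> B10_carrier"
    and R_add: "R (x + y) = (\<lambda>n i. R x n i + R y n i)" and R_scale: "R (smul a x) = (\<lambda>n i. a * R x n i)"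
    and norm_R: "B10_norm (R x) \<le> K * norm x"
    and \<Psi>_\<Phi>: "\<Psi> (\<Phi> x) = x" and R_\<Phi>: "R (\<Phi> x) = (\<lambda>n i. 0)"
    and \<Psi>_\<Theta>: "u \<in> B10_carrier \<Longrightarrow> \<Psi> (\<Theta> u) = 0" and R_\<Theta>: "u \<in> B10_carrier \<Longrightarrow> R (\<Theta> u) = u"
    and \<Phi>_\<Psi>: "\<Phi> (\<Psi> x) + \<Theta> (R x) = x"
begin

lemma \<Phi>_diff: "\<Phi> (x - y) = \<Phi> x - \<Phi> y"
  using \<Phi>_add[of "x - y" y] by simp

lemma \<Phi>_zero: "\<Phi> 0 = 0"
  using \<Phi>_diff[of 0 0] by simp

lemma \<Theta>_zero: "\<Theta> (\<lambda>n i. 0) = 0"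
  using \<Theta>_scale[OF B10_zero, of 0] by simp

lemma \<Theta>_diff:
  assumes "u \<in> B10_carrier" "v \<in> B10_carrier"
  shows "\<Theta> (\<lambda>n i. u n i - v n i) = \<Theta> u - \<Theta> v"
  using \<Theta>_add[OF B10_diff[OF assms] assms(2)] by simp

definition interleave :: "(nat \<Rightarrow> 'x) \<Rightarrow> nat \<Rightarrow> 'x" where
  "interleave B n = (if even n then \<Phi> (B (n div 2)) else \<Theta> (tree_vec (n div 2)))"

definition interleave_coord :: "(nat \<Rightarrow> 'x) \<Rightarrow> nat \<Rightarrow> 'x \<Rightarrow> 'f" where
  "interleave_coord B n x =
     (if even n then coord smul B (n div 2) (\<Psi> x) else tree_coord (n div 2) (R x))"

lemma interleave_coord_even: "interleave_coord B (2 * k) x = coord smul B k (\<Psi> x)"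
  and interleave_coord_odd: "interleave_coord B (Suc (2 * k)) x = tree_coord k (R x)"
  by (simp_all add: interleave_coord_def)

text \<open>Even and odd indices do not interact. The form with an arbitrary finite \<open>A\<close>
  serves the partial sums, the greedy projections and the lower bound alike.\<close>

lemma interleave_sum:
  assumes "finite A"
  shows "(\<Sum>n\<in>A. smul (interleave_coord B n x) (interleave B n))
    = \<Phi> (\<Sum>k | 2 * k \<in> A. smul (coord smul B k (\<Psi> x)) (B k)) + \<Theta> (tree_proj {k. Suc (2 * k) \<in> A} (R x))"
  using assms
proof (induction A rule: finite_induct)
  case empty
  show ?case by (simp add: \<Phi>_zero tree_proj_empty \<Theta>_zero)
next
  case (insert n A)
  have fin: "finite {k. 2 * k \<in> A}"
  proof -
    have "{k. 2 * k \<in> A} = (\<lambda>k. 2 * k) -` A" by (simp add: vimage_def)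
    then show ?thesis using insert.hyps(1) by (simp add: finite_vimageI inj_on_def)
  qed
  have fin': "finite {k. Suc (2 * k) \<in> A}"
  proof -
    have "{k. Suc (2 * k) \<in> A} = (\<lambda>k. Suc (2 * k)) -` A" by (simp add: vimage_def)
    then show ?thesis using insert.hyps(1) by (simp add: finite_vimageI inj_on_def)
  qed
  show ?case
  proof (cases "even n")
    case True
    then obtain m where m: "n = 2 * m" by (rule evenE)
    have odd: "{k. Suc (2 * k) \<in> insert n A} = {k. Suc (2 * k) \<in> A}"
    proof -
      have "Suc (2 * k) \<noteq> n" for k unfolding m by presburger
      then show ?thesis by simp
    qed
    have even: "{k. 2 * k \<in> insert n A} = insert m {k. 2 * k \<in> A}"
      unfolding m by (simp add: set_eq_iff)
    have "m \<notin> {k. 2 * k \<in> A}" using insert.hyps(2) m by simp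
    then have "\<Phi> (\<Sum>k | 2 * k \<in> insert n A. smul (coord smul B k (\<Psi> x)) (B k))
      = smul (interleave_coord B n x) (interleave B n) + \<Phi> (\<Sum>k | 2 * k \<in> A. smul (coord smul B k (\<Psi> x)) (B k))"
      unfolding even using fin by (simp add: \<Phi>_add \<Phi>_scale m interleave_def interleave_coord_def)
    then show ?thesis
      unfolding odd sum.insert[OF insert.hyps] insert.IH by (simp add: add.assoc)
  next
    case False
    then have "n = Suc (2 * (n div 2))" by presburger
    then obtain m where m: "n = Suc (2 * m)" by (rule that)
    have even: "{k. 2 * k \<in> insert n A} = {k. 2 * k \<in> A}"
    proof -
      have "2 * k \<noteq> n" for k unfolding m by presburger
      then show ?thesis by simp
    qed
    have odd: "{k. Suc (2 * k) \<in> insert n A} = insert m {k. Suc (2 * k) \<in> A}"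
      unfolding m by (simp add: set_eq_iff)
    have "m \<notin> {k. Suc (2 * k) \<in> A}" using insert.hyps(2) m by simp
    then have "tree_proj {k. Suc (2 * k) \<in> insert n A} (R x)
      = (\<lambda>n i. tree_proj {k. Suc (2 * k) \<in> A} (R x) n i + tree_coord m (R x) * tree_vec m n i)"
      unfolding odd by (rule tree_proj_insert)
    then have "\<Theta> (tree_proj {k. Suc (2 * k) \<in> insert n A} (R x))
      = \<Theta> (tree_proj {k. Suc (2 * k) \<in> A} (R x)) + smul (interleave_coord B n x) (interleave B n)"
      using \<Theta>_add[OF tree_proj_carrier[OF fin'] B10_scale[OF tree_vec_carrier(1)]]
      by (simp add: \<Theta>_scale[OF tree_vec_carrier(1)] m interleave_def interleave_coord_def)
    then show ?thesis
      unfolding even sum.insert[OF insert.hyps] insert.IH by (simp add: ac_simps)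
  qed
qed

lemma interleave_sums:
  assumes B: "schauder_basis smul B"
  shows "(\<lambda>n. smul (interleave_coord B n x) (interleave B n)) sums x"
proof -
  define S where "S N = (\<Sum>k<N. smul (coord smul B k (\<Psi> x)) (B k))" for N
  define T where "T N = tree_proj {..<N} (R x)" for N
  have T: "T N \<in> B10_carrier" for N unfolding T_def by (rule tree_proj_carrier) simp
  have split: "(\<Sum>n<N. smul (interleave_coord B n x) (interleave B n)) - x
    = \<Phi> (S ((N + 1) div 2) - \<Psi> x) - \<Theta> (\<lambda>n i. R x n i - T (N div 2) n i)" for N
  proof -
    have "{k. 2 * k \<in> {..<N}} = {..<(N + 1) div 2}"
      unfolding set_eq_iff lessThan_iff mem_Collect_eq by presburger
    moreover have "{k. Suc (2 * k) \<in> {..<N}} = {..<N div 2}"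
      unfolding set_eq_iff lessThan_iff mem_Collect_eq by presburger
    ultimately have "(\<Sum>n<N. smul (interleave_coord B n x) (interleave B n))
      = \<Phi> (S ((N + 1) div 2)) + \<Theta> (T (N div 2))"
      unfolding S_def T_def by (simp only: interleave_sum[OF finite_lessThan])
    moreover have "(p + q) - (p' + q') = (p - p') - (q' - q)" for p q p' q' :: 'x by simp
    from this[of _ _ "\<Phi> (\<Psi> x)" "\<Theta> (R x)"] have "(p + q) - x = (p - \<Phi> (\<Psi> x)) - (\<Theta> (R x) - q)" for p q
      unfolding \<Phi>_\<Psi> .
    ultimately show ?thesis unfolding \<Phi>_diff \<Theta>_diff[OF R_carrier T] by (simp only:)
  qed
  have f1: "filterlim (\<lambda>N. (N + 1) div 2 :: nat) at_top sequentially"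
    unfolding filterlim_at_top
  proof
    fix Z :: nat
    show "\<forall>\<^sub>F N in sequentially. Z \<le> (N + 1) div 2"
      by (rule eventually_sequentiallyI[of "2 * Z"]) linarith
  qed
  have l0: "(\<lambda>N. norm (S N - \<Psi> x)) \<longlonglongrightarrow> 0"
    using coord_sums[OF B, of "\<Psi> x"] unfolding sums_def S_def
    by (intro tendsto_norm_zero) (simp add: LIM_zero_iff)
  note l1 = filterlim_compose[OF l0 f1]
  have f2: "filterlim (\<lambda>N. N div 2 :: nat) at_top sequentially"
    unfolding filterlim_at_top
  proof
    fix Z :: nat
    show "\<forall>\<^sub>F N in sequentially. Z \<le> N div 2"
      by (rule eventually_sequentiallyI[of "2 * Z"]) linarith
  qed
  have l0': "(\<lambda>N. B10_norm (\<lambda>n i. R x n i - T N n i)) \<longlonglongrightarrow> 0"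
    unfolding T_def by (rule tree_proj_tendsto[OF R_carrier])
  note l2 = filterlim_compose[OF l0' f2]
  have lim: "(\<lambda>N. K * norm (S ((N + 1) div 2) - \<Psi> x) + K * B10_norm (\<lambda>n i. R x n i - T (N div 2) n i)) \<longlonglongrightarrow> 0"
    using tendsto_add[OF tendsto_mult_right_zero[OF l1, of K] tendsto_mult_right_zero[OF l2, of K]] by simp
  have "(\<lambda>N. (\<Sum>n<N. smul (interleave_coord B n x) (interleave B n)) - x) \<longlonglongrightarrow> 0"
  proof (rule Lim_null_comparison[OF always_eventually lim], rule allI)
    fix N
    show "norm ((\<Sum>n<N. smul (interleave_coord B n x) (interleave B n)) - x)
      \<le> K * norm (S ((N + 1) div 2) - \<Psi> x) + K * B10_norm (\<lambda>n i. R x n i - T (N div 2) n i)"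
      unfolding split
      by (intro order_trans[OF norm_triangle_ineq4] add_mono norm_\<Phi> norm_\<Theta> B10_diff R_carrier T)
  qed
  then show ?thesis unfolding sums_def by (simp add: LIM_zero_iff)
qed

lemma interleave_basis:
  assumes B: "quasi_greedy_basis smul B"
  shows "schauder_basis smul (interleave B)" "coord smul (interleave B) n x = interleave_coord B n x"
proof -
  obtain C \<delta> \<beta> where sb: "schauder_basis smul B" and "0 < C" and \<delta>: "0 < \<delta>" "\<And>n. \<delta> \<le> norm (B n)"
    and "\<And>n. norm (B n) \<le> \<beta>"
    and greedy: "\<And>f A. greedy_set B f A \<Longrightarrow> norm (f - coord_proj smul B A f) \<le> C * norm f"
    using quasi_greedy_basisE[OF B] by blast
  have C: "0 \<le> 2 * C / \<delta>" using \<open>0 < C\<close> \<delta>(1) by simp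
  have c_add: "interleave_coord B n (x + y) = interleave_coord B n x + interleave_coord B n y" for n x y
    by (simp add: interleave_coord_def \<Psi>_add coord_add[OF sb] R_add tree_coord_add)
  have c_scale: "interleave_coord B n (smul a x) = a * interleave_coord B n x" for n a x
    by (simp add: interleave_coord_def \<Psi>_scale coord_scale[OF sb] R_scale tree_coord_scale)
  have c_bounded: "\<exists>L. \<forall>x. norm (interleave_coord B n x) \<le> L * norm x" for n
  proof (cases "even n")
    case True
    have "norm (interleave_coord B n x) \<le> (2 * C / \<delta> * K) * norm x" for x
    proof -
      have "norm (interleave_coord B n x) \<le> 2 * C / \<delta> * norm (\<Psi> x)"
        using True coord_bounded[OF sb \<delta> greedy] by (simp add: interleave_coord_def)
      also have "\<dots> \<le> 2 * C / \<delta> * (K * norm x)" using norm_\<Psi> C by (rule mult_left_mono)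
      finally show ?thesis by (simp only: mult.assoc)
    qed
    then show ?thesis by blast
  next
    case False
    have "norm (interleave_coord B n x) \<le> (2 * K) * norm x" for x
    proof -
      have "norm (interleave_coord B n x) \<le> 2 * B10_norm (R x)"
        using False norm_tree_coord_le[OF R_carrier] by (simp add: interleave_coord_def)
      then show ?thesis using norm_R[of x] by simp
    qed
    then show ?thesis by blast
  qed
  have c_delta: "interleave_coord B n (interleave B m) = (if n = m then 1 else 0)" for n m
  proof -
    have tz: "tree_coord k (\<lambda>n i. 0) = (0 :: 'f)" for k
      using tree_coord_scale[of k 0 "\<lambda>n i. 0 :: 'f"] by simp
    have cz: "coord smul B k 0 = 0" for k
      using coord_scale[OF sb, of k 0 0] by simp
    show ?thesis
    proof (cases "even n = even m")
      case True
      then have nm: "n div 2 = m div 2 \<longleftrightarrow> n = m" by presburger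
      show ?thesis
      proof (cases "even n")
        case n: True
        then show ?thesis using True
          by (simp add: interleave_coord_def interleave_def \<Psi>_\<Phi> coord_basis[OF sb] nm)
      next
        case n: False
        then show ?thesis using True
          by (simp add: interleave_coord_def interleave_def R_\<Theta> tree_vec_carrier(1) tree_coord_vec nm)
      qed
    next
      case False
      then have nm: "n \<noteq> m" by blast
      show ?thesis
      proof (cases "even n")
        case n: True
        then show ?thesis using False nm
          by (simp add: interleave_coord_def interleave_def \<Psi>_\<Theta> tree_vec_carrier(1) cz)
      next
        case n: False
        then show ?thesis using False nm
          by (simp add: interleave_coord_def interleave_def R_\<Phi> tz)
      qed
    qed
  qed
  show "schauder_basis smul (interleave B)"
    by (rule schauder_basis_coord(1)[where c = "interleave_coord B"])
      (rule c_add c_scale c_bounded c_delta interleave_sums[OF sb])+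
  show "coord smul (interleave B) n x = interleave_coord B n x"
    by (rule schauder_basis_coord(2)[where c = "interleave_coord B"])
      (rule c_add c_scale c_bounded c_delta interleave_sums[OF sb])+
qed

lemma norm_interleave_bounds:
  assumes \<delta>: "0 < \<delta>" "\<And>n. \<delta> \<le> norm (B n)" and \<beta>: "\<And>n. norm (B n) \<le> \<beta>"
  shows "min \<delta> (1 / 2) / K \<le> norm (interleave B n)" "norm (interleave B n) \<le> K * max \<beta> 2"
proof -
  have "min \<delta> (1 / 2) \<le> K * norm (interleave B n)"
  proof (cases "even n")
    case True
    have "min \<delta> (1 / 2) \<le> norm (B (n div 2))" using \<delta>(2)[of "n div 2"] by simp
    also have "\<dots> = norm (\<Psi> (interleave B n))" using True by (simp add: interleave_def \<Psi>_\<Phi>)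
    also have "\<dots> \<le> K * norm (interleave B n)" by (rule norm_\<Psi>)
    finally show ?thesis .
  next
    case False
    \<comment> \<open>The vector has own coordinate 1, while the coordinate functional has norm at
      most 2; hence the \<open>1 / 2\<close> in the lower bound.\<close>
    have "1 = norm (tree_coord (n div 2) (tree_vec (n div 2) :: nat \<Rightarrow> nat \<Rightarrow> 'f))"
      by (simp add: tree_coord_vec)
    also have "\<dots> \<le> 2 * B10_norm (tree_vec (n div 2) :: nat \<Rightarrow> nat \<Rightarrow> 'f)"
      by (rule norm_tree_coord_le[OF tree_vec_carrier(1)])
    also have "(tree_vec (n div 2) :: nat \<Rightarrow> nat \<Rightarrow> 'f) = R (interleave B n)"
      using False by (simp add: interleave_def R_\<Theta>[OF tree_vec_carrier(1)])
    finally show ?thesis using norm_R[of "interleave B n"] by linarith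
  qed
  then show "min \<delta> (1 / 2) / K \<le> norm (interleave B n)"
    using K_pos by (simp add: pos_divide_le_eq mult.commute)
  show "norm (interleave B n) \<le> K * max \<beta> 2"
  proof (cases "even n")
    case True
    have "norm (interleave B n) \<le> K * norm (B (n div 2))"
      using True norm_\<Phi> by (simp add: interleave_def)
    also have "\<dots> \<le> K * max \<beta> 2" using \<beta>[of "n div 2"] K_pos by (intro mult_left_mono) simp_all
    finally show ?thesis .
  next
    case False
    have "norm (interleave B n) \<le> K * B10_norm (tree_vec (n div 2) :: nat \<Rightarrow> nat \<Rightarrow> 'f)"
      using False norm_\<Theta>[OF tree_vec_carrier(1)] by (simp add: interleave_def)
    also have "\<dots> \<le> K * max \<beta> 2"
      using tree_vec_carrier(2)[of "n div 2", where ?'f = 'f] K_pos by (intro mult_left_mono) simp_all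
    finally show ?thesis .
  qed
qed

lemma interleave_quasi_greedy:
  assumes B: "quasi_greedy_basis smul B"
  shows "quasi_greedy_basis smul (interleave B)"
proof -
  obtain C \<delta> \<beta> where sb: "schauder_basis smul B" and C: "0 < C" and \<delta>: "0 < \<delta>" "\<And>n. \<delta> \<le> norm (B n)"
    and \<beta>: "\<And>n. norm (B n) \<le> \<beta>"
    and greedy: "\<And>f A. greedy_set B f A \<Longrightarrow> norm (f - coord_proj smul B A f) \<le> C * norm f"
    using quasi_greedy_basisE[OF B] by blast
  note bounds = norm_interleave_bounds[of \<delta> B \<beta>, OF \<delta> \<beta>]
  have low: "0 < min \<delta> (1 / 2) / K" using \<delta>(1) K_pos by simp
  \<comment> \<open>Each summand is entered through \<open>\<Psi>\<close> or \<open>R\<close> and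
    left through \<open>\<Phi>\<close> or \<open>\<Theta>\<close>, at the cost of \<open>K\<close>
    each way; in between stand the greedy constants \<open>C\<close> and 6.\<close>
  define L where "L = K * (C * K) + K * (6 * K)"
  have L: "0 \<le> L" using C K_pos by (simp add: L_def)
  have "norm (f - coord_proj smul (interleave B) A f) \<le> L * norm f"
    if A: "greedy_set (interleave B) f A" for f A
  proof (rule greedy_bound_finite[OF interleave_basis(1)[OF B] _ _ L A])
    show "(\<lambda>n. coord smul (interleave B) n f) \<longlonglongrightarrow> 0"
      by (rule coord_tendsto_zero[OF interleave_basis(1)[OF B] low bounds(1)])
    fix A assume fin: "finite A" and gr: "greedy_set (interleave B) f A"
    define A0 where "A0 = {k. 2 * k \<in> A}"
    define A1 where "A1 = {k. Suc (2 * k) \<in> A}"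
    have finA0: "finite A0"
    proof -
      have "A0 = (\<lambda>k. 2 * k) -` A" by (simp add: vimage_def A0_def)
      then show ?thesis using fin by (simp add: finite_vimageI inj_on_def)
    qed
    have finA1: "finite A1"
    proof -
      have "A1 = (\<lambda>k. Suc (2 * k)) -` A" by (simp add: vimage_def A1_def)
      then show ?thesis using fin by (simp add: finite_vimageI inj_on_def)
    qed
    have le: "norm (interleave_coord B j f) \<le> norm (interleave_coord B k f)" if "j \<notin> A" "k \<in> A" for j k
      using gr that unfolding greedy_set_def interleave_basis(2)[OF B] by blast
    have "greedy_set B (\<Psi> f) A0"
      unfolding greedy_set_def
    proof (intro allI impI)
      fix j k assume "j \<notin> A0" "k \<in> A0"
      then show "norm (coord smul B j (\<Psi> f)) \<le> norm (coord smul B k (\<Psi> f))"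
        using le[of "2 * j" "2 * k"] by (simp add: A0_def interleave_coord_even)
    qed
    from greedy[OF this] have "norm (\<Psi> f - (\<Sum>k\<in>A0. smul (coord smul B k (\<Psi> f)) (B k))) \<le> C * norm (\<Psi> f)"
      by (simp add: coord_proj_finite[OF finA0])
    also have "\<dots> \<le> C * (K * norm f)" using norm_\<Psi> C by (intro mult_left_mono) simp_all
    finally have p0: "norm (\<Psi> f - (\<Sum>k\<in>A0. smul (coord smul B k (\<Psi> f)) (B k))) \<le> C * (K * norm f)" .
    have "B10_norm (\<lambda>n i. R f n i - tree_proj A1 (R f) n i) \<le> 6 * B10_norm (R f)"
    proof (rule tree_proj_greedy[OF R_carrier])
      fix j k assume "j \<notin> A1" "k \<in> A1"
      then show "norm (tree_coord j (R f)) \<le> norm (tree_coord k (R f))"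
        using le[of "Suc (2 * j)" "Suc (2 * k)"] by (simp add: A1_def interleave_coord_odd)
    qed
    also have "\<dots> \<le> 6 * (K * norm f)" using norm_R by (intro mult_left_mono) simp_all
    finally have p1: "B10_norm (\<lambda>n i. R f n i - tree_proj A1 (R f) n i) \<le> 6 * (K * norm f)" .
    have "(p' + q') - (p + q) = (p' - p) + (q' - q)" for p q p' q' :: 'x by simp
    from this[of "\<Phi> (\<Psi> f)" "\<Theta> (R f)"]
    have "f - (\<Sum>n\<in>A. smul (interleave_coord B n f) (interleave B n))
      = (\<Phi> (\<Psi> f) - \<Phi> (\<Sum>k\<in>A0. smul (coord smul B k (\<Psi> f)) (B k))) + (\<Theta> (R f) - \<Theta> (tree_proj A1 (R f)))"
      unfolding \<Phi>_\<Psi> interleave_sum[OF fin] A0_def A1_def by (simp only:)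
    also have "\<dots> = \<Phi> (\<Psi> f - (\<Sum>k\<in>A0. smul (coord smul B k (\<Psi> f)) (B k)))
      + \<Theta> (\<lambda>n i. R f n i - tree_proj A1 (R f) n i)"
      unfolding \<Phi>_diff \<Theta>_diff[OF R_carrier tree_proj_carrier[OF finA1]] ..
    finally have eq: "f - (\<Sum>n\<in>A. smul (interleave_coord B n f) (interleave B n))
      = \<Phi> (\<Psi> f - (\<Sum>k\<in>A0. smul (coord smul B k (\<Psi> f)) (B k)))
      + \<Theta> (\<lambda>n i. R f n i - tree_proj A1 (R f) n i)" .
    have q0: "norm (\<Phi> (\<Psi> f - (\<Sum>k\<in>A0. smul (coord smul B k (\<Psi> f)) (B k)))) \<le> K * (C * (K * norm f))"
      using p0 K_pos by (intro order_trans[OF norm_\<Phi>] mult_left_mono) simp_all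
    have q1: "norm (\<Theta> (\<lambda>n i. R f n i - tree_proj A1 (R f) n i)) \<le> K * (6 * (K * norm f))"
      using p1 K_pos
      by (intro order_trans[OF norm_\<Theta>[OF B10_diff[OF R_carrier tree_proj_carrier[OF finA1]]]] mult_left_mono) simp_all
    have "norm (f - (\<Sum>n\<in>A. smul (interleave_coord B n f) (interleave B n)))
      \<le> K * (C * (K * norm f)) + K * (6 * (K * norm f))"
      unfolding eq by (rule norm_triangle_mono[OF q0 q1])
    also have "\<dots> = L * norm f" by (simp add: L_def algebra_simps)
    finally show "norm (f - (\<Sum>n\<in>A. smul (coord smul (interleave B) n f) (interleave B n))) \<le> L * norm f"
      unfolding interleave_basis(2)[OF B] .
  qed
  then have "\<exists>C. \<forall>f A. greedy_set (interleave B) f A \<longrightarrow>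
      norm (f - coord_proj smul (interleave B) A f) \<le> C * norm f" by blast
  moreover have "min \<delta> (1 / 2) / K \<le> (INF j. norm (interleave B j))"
    by (rule cINF_greatest) (simp_all only: bounds UNIV_not_empty not_False_eq_True)
  then have "0 < (INF j. norm (interleave B j))" using low by linarith
  moreover have "bdd_above (range (\<lambda>j. norm (interleave B j)))"
    by (rule bdd_aboveI2[where M = "K * max \<beta> 2"]) (rule bounds)
  ultimately show ?thesis
    unfolding quasi_greedy_basis_def greedy_set_def using interleave_basis(1)[OF B] by (intro conjI)
qed

text \<open>Block \<open>4 * q\<close> ends at the tree index
  \<open>triangle (4 * q) + 4 * q\<close>, which is \<open>8 * q\<^sup>2 + 6 * q\<close>; its odd
  position in the interleaved basis is \<open>16 * q\<^sup>2 + 12 * q + 1\<close>. The factor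
  \<open>8 * K\<^sup>2\<close> collects the 4 of the estimate in the block, one \<open>K\<close> for
  reading the projection through \<open>R\<close>, and the bound \<open>2 * K\<close> on the norm of
  \<open>f\<close>.\<close>

lemma interleave_lower:
  assumes B: "quasi_greedy_basis smul B"
  shows "\<exists>f A. f \<noteq> 0 \<and> supp smul (interleave B) f \<subseteq> {..16 * q\<^sup>2 + 12 * q + 1} \<and>
    ln (real q + 1) / (8 * K\<^sup>2) \<le> norm (coord_proj smul (interleave B) A f) / norm f"
proof -
  obtain u :: "nat \<Rightarrow> nat \<Rightarrow> 'f" and A where u: "u \<in> B10_carrier" and A: "finite A"
    and u1: "1 \<le> B10_norm u" and u2: "B10_norm u \<le> 2"
    and u0': "\<forall>k>triangle (4 * q) + 4 * q. tree_coord k u = 0"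
    and low: "ln (real q + 1) / 4 \<le> B10_norm (tree_proj A u)"
    using ex_tree_proj_ge_ln[of q] by (elim bexE exE conjE) (rule that)
  have u0: "tree_coord k u = 0" if "triangle (4 * q) + 4 * q < k" for k
    using u0' that by blast
  define f where "f = \<Theta> u"
  have coord: "coord smul (interleave B) n f = (if even n then 0 else tree_coord (n div 2) u)" for n
  proof -
    have sb: "schauder_basis smul B" using B unfolding quasi_greedy_basis_def by (rule conjunct1)
    have "coord smul B k 0 = 0" for k using coord_scale[OF sb, of k 0 0] by simp
    then show ?thesis
      unfolding interleave_basis(2)[OF B] interleave_coord_def f_def by (simp add: \<Psi>_\<Theta>[OF u] R_\<Theta>[OF u])
  qed
  have tri: "triangle (4 * q) = 8 * q\<^sup>2 + 2 * q"
  proof -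
    have "triangle (4 * q) = (2 * (8 * q\<^sup>2 + 2 * q)) div 2"
      unfolding triangle_def by (rule arg_cong[where f = "\<lambda>n. n div 2"]) (simp add: power2_eq_square algebra_simps)
    then show ?thesis by simp
  qed
  have supp: "supp smul (interleave B) f \<subseteq> {..16 * q\<^sup>2 + 12 * q + 1}"
  proof
    fix n assume "n \<in> supp smul (interleave B) f"
    then have n: "odd n" "tree_coord (n div 2) u \<noteq> 0"
      unfolding supp_def coord by (simp_all split: if_splits)
    then have "n div 2 \<le> triangle (4 * q) + 4 * q" using u0[of "n div 2"] by (simp only: not_less[symmetric]) blast
    then show "n \<in> {..16 * q\<^sup>2 + 12 * q + 1}" unfolding tri by simp
  qed
  have "B10_norm u \<le> K * norm f" using norm_R[of f] by (simp add: f_def R_\<Theta>[OF u])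
  then have f0: "f \<noteq> 0" using u1 by fastforce
  define A' where "A' = (\<lambda>k. Suc (2 * k)) ` A"
  have finA': "finite A'" using A by (simp add: A'_def)
  have "coord_proj smul (interleave B) A' f
    = (\<Sum>n\<in>A'. smul (interleave_coord B n f) (interleave B n))"
    by (simp only: coord_proj_finite[OF finA'] interleave_basis(2)[OF B])
  also have "\<dots> = \<Theta> (tree_proj A u)"
  proof -
    have e: "{k. 2 * k \<in> A'} = {}"
    proof -
      have "2 * k \<noteq> Suc (2 * l)" for k l :: nat by presburger
      then show ?thesis unfolding A'_def by blast
    qed
    have o: "{k. Suc (2 * k) \<in> A'} = A" unfolding A'_def by (simp add: image_iff)
    show ?thesis unfolding interleave_sum[OF finA'] e o by (simp add: \<Phi>_zero f_def R_\<Theta>[OF u])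
  qed
  finally have proj: "coord_proj smul (interleave B) A' f = \<Theta> (tree_proj A u)" .
  have "ln (real q + 1) / 4 \<le> K * norm (\<Theta> (tree_proj A u))"
    using low norm_R[of "\<Theta> (tree_proj A u)"] unfolding R_\<Theta>[OF tree_proj_carrier[OF A]] by linarith
  then have "ln (real q + 1) / (4 * K) \<le> norm (\<Theta> (tree_proj A u))"
    using K_pos by (simp add: field_simps)
  moreover have "norm f \<le> K * 2"
    unfolding f_def using u2 K_pos by (intro order_trans[OF norm_\<Theta>[OF u]] mult_left_mono) simp_all
  moreover have "0 \<le> ln (real q + 1) / (4 * K)" using K_pos by simp
  ultimately have "ln (real q + 1) / (4 * K) / (K * 2) \<le> norm (\<Theta> (tree_proj A u)) / norm f"
    using f0 by (intro frac_le) simp_all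
  then have "ln (real q + 1) / (8 * K\<^sup>2) \<le> norm (coord_proj smul (interleave B) A' f) / norm f"
    unfolding proj by (simp add: power2_eq_square)
  then show ?thesis using f0 supp by blast
qed

lemma interleave_L_const:
  assumes B: "quasi_greedy_basis smul B"
  shows "approx_on {2..} (L_const smul (interleave B)) (\<lambda>m. ln (real m))"
proof -
  define Q where "Q m = {norm (coord_proj smul (interleave B) A f) / norm f | f A.
      f \<noteq> 0 \<and> supp smul (interleave B) f \<subseteq> {..<m}}" for m
  have L: "L_const smul (interleave B) m = Sup (Q m)" for m
    unfolding L_const_def Q_def ..
  note sb = interleave_basis(1)[OF B]
  obtain C where C: "\<And>m f A. 2 \<le> m \<Longrightarrow> supp smul (interleave B) f \<subseteq> {..<m} \<Longrightarrow>
    norm (coord_proj smul (interleave B) A f) \<le> C * ln (real m) * norm f"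
    using norm_coord_proj_le_ln[OF interleave_quasi_greedy[OF B]] by blast
  have upper: "r \<le> C * ln (real m)" if m: "2 \<le> m" and r: "r \<in> Q m" for m r
  proof -
    obtain f A where fA: "f \<noteq> 0" "supp smul (interleave B) f \<subseteq> {..<m}"
      "r = norm (coord_proj smul (interleave B) A f) / norm f"
      using r unfolding Q_def by blast
    then show ?thesis using C[OF m fA(2), of A] by (simp add: divide_le_eq)
  qed
  have bdd: "bdd_above (Q m)" if "2 \<le> m" for m
    using upper[OF that] by (rule bdd_aboveI)
  \<comment> \<open>The full projection shows that the constants are at least 1, which later absorbs
    the additive term \<open>ln 29\<close>.\<close>
  have one: "1 \<in> Q m" if m: "2 \<le> m" for m
  proof -
    have c: "coord smul (interleave B) n (interleave B 0) = (if n = 0 then 1 else 0)" for n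
      by (rule coord_basis[OF sb])
    have "interleave B 0 \<noteq> 0"
    proof
      assume "interleave B 0 = 0"
      then have "coord smul (interleave B) 0 (interleave B 0) = 0"
        using coord_scale[OF sb, of 0 0 0] by simp
      then show False using c[of 0] by simp
    qed
    moreover have "supp smul (interleave B) (interleave B 0) \<subseteq> {..<m}"
      unfolding supp_def c using m by (simp add: subset_iff)
    moreover have "coord_proj smul (interleave B) UNIV (interleave B 0) = interleave B 0"
      by (rule coord_proj_supp[OF sb subset_UNIV])
    ultimately show ?thesis
      unfolding Q_def mem_Collect_eq by (intro exI[of _ "interleave B 0"] exI[of _ UNIV]) simp
  qed
  have "lesssim_on {2..} (L_const smul (interleave B)) (\<lambda>m. ln (real m))"
    unfolding lesssim_on_def
  proof (intro exI[of _ C] ballI)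
    fix m :: nat assume "m \<in> {2..}"
    then have m: "2 \<le> m" by simp
    have "Q m \<noteq> {}" using one[OF m] by blast
    then show "L_const smul (interleave B) m \<le> C * ln (real m)"
      unfolding L by (rule cSup_least) (rule upper[OF m])
  qed
  moreover have "lesssim_on {2..} (\<lambda>m. ln (real m)) (L_const smul (interleave B))"
    unfolding lesssim_on_def
  proof (intro exI[of _ "ln 29 + 16 * K\<^sup>2"] ballI)
    fix m :: nat assume "m \<in> {2..}"
    then have m: "2 \<le> m" by simp
    \<comment> \<open>The first \<open>p\<close> for which block \<open>4 * p\<close> no longer fits
      into \<open>{..<m}\<close>. It is positive as \<open>m \<ge> 2\<close>, and its predecessor
      \<open>q\<close> provides the test vector.\<close>
    define p where "p = (LEAST p. m \<le> 16 * p\<^sup>2 + 12 * p + 1)"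
    have "m \<le> 16 * m\<^sup>2 + 12 * m + 1" by simp
    then have p: "m \<le> 16 * p\<^sup>2 + 12 * p + 1" unfolding p_def by (rule LeastI)
    then obtain q where q: "p = Suc q" using m by (cases p) simp_all
    have "\<not> m \<le> 16 * q\<^sup>2 + 12 * q + 1"
      using not_less_Least[of q "\<lambda>p. m \<le> 16 * p\<^sup>2 + 12 * p + 1"] q unfolding p_def[symmetric] by simp
    then have sub: "{..16 * q\<^sup>2 + 12 * q + 1} \<subseteq> {..<m}" by (simp add: subset_iff)
    obtain f A where f: "f \<noteq> 0" "supp smul (interleave B) f \<subseteq> {..16 * q\<^sup>2 + 12 * q + 1}"
      and low: "ln (real q + 1) / (8 * K\<^sup>2) \<le> norm (coord_proj smul (interleave B) A f) / norm f"
      using interleave_lower[OF B, of q] by blast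
    have "norm (coord_proj smul (interleave B) A f) / norm f \<in> Q m"
      unfolding Q_def using f(1) subset_trans[OF f(2) sub] by blast
    then have "norm (coord_proj smul (interleave B) A f) / norm f \<le> L_const smul (interleave B) m"
      unfolding L by (rule cSup_upper) (rule bdd[OF m])
    then have "ln (real q + 1) / (8 * K\<^sup>2) \<le> L_const smul (interleave B) m" using low by linarith
    then have a: "2 * ln (real q + 1) \<le> 16 * K\<^sup>2 * L_const smul (interleave B) m"
      using K_pos by (simp add: field_simps)
    have b: "1 \<le> L_const smul (interleave B) m"
      unfolding L using one[OF m] bdd[OF m] by (rule cSup_upper)
    \<comment> \<open>Here 29 is \<open>16 + 12 + 1\<close>, by \<open>p \<ge> 1\<close>. The square
      doubles the logarithm and turns \<open>8 * K\<^sup>2\<close> into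
      \<open>16 * K\<^sup>2\<close>.\<close>
    have "16 * p\<^sup>2 + 12 * p + 1 \<le> 29 * p\<^sup>2"
      unfolding q by (simp add: power2_eq_square)
    then have "m \<le> 29 * p\<^sup>2" using p by linarith
    then have "real m \<le> real (29 * p\<^sup>2)" by (simp only: of_nat_le_iff)
    then have "real m \<le> 29 * (real q + 1)\<^sup>2" by (simp add: q add.commute)
    then have "ln (real m) \<le> ln (29 * (real q + 1)\<^sup>2)" using m by (intro ln_mono) simp_all
    also have "\<dots> = ln 29 + 2 * ln (real q + 1)" by (simp add: ln_mult ln_realpow)
    also have "\<dots> \<le> ln 29 * L_const smul (interleave B) m + 16 * K\<^sup>2 * L_const smul (interleave B) m"
    proof -
      have "ln 29 * 1 \<le> ln 29 * L_const smul (interleave B) m"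
        by (rule mult_left_mono[OF b]) simp
      then show ?thesis using a by linarith
    qed
    finally show "ln (real m) \<le> (ln 29 + 16 * K\<^sup>2) * L_const smul (interleave B) m"
      by (simp add: distrib_right)
  qed
  ultimately show ?thesis unfolding approx_on_def by (rule conjI)
qed

end

section \<open>Splitting off the summand\<close>

text \<open>The space is the sum of the kernel of the projection and a copy of
  \<open>B10_carrier\<close>. \<open>\<Phi>\<close> and \<open>\<Psi>\<close> fix the kernel and act
  as \<open>hotel_shift\<close> and \<open>hotel_unshift\<close> on the copy; this frees the room
  that \<open>\<Theta>\<close> fills and \<open>R\<close> reads.\<close>

lemma (in banach_over) ex_B10_summand:
  assumes "complemented_subspace smul Y" "B10_isomorphic_to smul Y"
  shows "\<exists>\<Phi> \<Psi> \<Theta> R K. B10_summand smul \<Phi> \<Psi> \<Theta> R K"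
proof -
  obtain P J where lin: "Vector_Spaces.linear smul smul P" and J: "\<And>x. norm (P x) \<le> J * norm x"
    and PP: "\<And>x. P (P x) = P x" and rP: "range P = Y"
    using assms(1) unfolding complemented_subspace_def by blast
  have P_add: "P (x + y) = P x + P y" and P_scale: "P (smul a x) = smul a (P x)" for x y a
    using lin unfolding Vector_Spaces.linear_iff by blast+
  have P_diff: "P (x - y) = P x - P y" for x y using P_add[of "x - y" y] by simp
  obtain T :: "(nat \<Rightarrow> nat \<Rightarrow> 'f) \<Rightarrow> 'x" where "bij_betw T B10_carrier Y \<and>
        (\<forall>u\<in>B10_carrier. \<forall>v\<in>B10_carrier. T (\<lambda>n i. u n i + v n i) = T u + T v) \<and>
        (\<forall>c. \<forall>u\<in>B10_carrier. T (\<lambda>n i. c * u n i) = smul c (T u)) \<and>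
        (\<exists>c>0. \<exists>K. \<forall>u\<in>B10_carrier. c * B10_norm u \<le> norm (T u) \<and> norm (T u) \<le> K * B10_norm u)"
    using assms(2) unfolding B10_isomorphic_to_def by (rule exE)
  then obtain c L where bij: "bij_betw T B10_carrier Y"
    and T_add: "\<And>u v. u \<in> B10_carrier \<Longrightarrow> v \<in> B10_carrier \<Longrightarrow> T (\<lambda>n i. u n i + v n i) = T u + T v"
    and T_scale: "\<And>a u. u \<in> B10_carrier \<Longrightarrow> T (\<lambda>n i. a * u n i) = smul a (T u)"
    and c: "0 < c" and low: "\<And>u. u \<in> B10_carrier \<Longrightarrow> c * B10_norm u \<le> norm (T u)"
    and upp: "\<And>u. u \<in> B10_carrier \<Longrightarrow> norm (T u) \<le> L * B10_norm u"
    by blast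
  define J' where "J' = max J 0"
  define L' where "L' = max L 0"
  have J': "norm (P x) \<le> J' * norm x" and J0: "0 \<le> J'" for x
    using J[of x] mult_right_mono[of J J' "norm x"] by (simp_all add: J'_def)
  have upp': "norm (T u) \<le> L' * B10_norm u" if "u \<in> B10_carrier" for u
    using upp[OF that] mult_right_mono[of L L' "B10_norm u"] B10_norm_nonneg[OF that] by (simp add: L'_def)
  have L0: "0 \<le> L'" by (simp add: L'_def)
  have inj: "u = v" if "u \<in> B10_carrier" "v \<in> B10_carrier" "T u = T v" for u v
    using bij that unfolding bij_betw_def by (blast dest: inj_onD)
  have im: "T ` B10_carrier = Y" using bij by (rule bij_betw_imp_surj_on)
  \<comment> \<open>The component in the copy, read as an element of \<open>B10_carrier\<close>. Its
    linearity and its values are checked by applying the injective \<open>T\<close>, as in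
    \<open>S_eqI\<close>.\<close>
  define S where "S x = inv_into B10_carrier T (P x)" for x
  have mem: "P x \<in> T ` B10_carrier" for x unfolding im rP[symmetric] by (rule rangeI)
  have S: "S x \<in> B10_carrier" for x unfolding S_def by (rule inv_into_into[OF mem])
  have TS: "T (S x) = P x" for x unfolding S_def by (rule f_inv_into_f[OF mem])
  have S_eqI: "S x = u" if "u \<in> B10_carrier" "P x = T u" for x u
    using that by (intro inj[OF S]) (simp_all add: TS)
  have PT: "P (T u) = T u" if u: "u \<in> B10_carrier" for u
  proof -
    have "T u \<in> range P" unfolding rP im[symmetric] using u by (rule imageI)
    then obtain x where "T u = P x" by (rule imageE)
    then show ?thesis by (simp only: PP)
  qed
  have T0: "T (\<lambda>n i. 0) = 0" using T_scale[OF B10_zero, of 0] by simp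
  have S_add: "S (x + y) = (\<lambda>n i. S x n i + S y n i)" for x y
    by (rule S_eqI[OF B10_add[OF S S]]) (simp only: P_add T_add[OF S S] TS)
  have S_scale: "S (smul a x) = (\<lambda>n i. a * S x n i)" for a x
    by (rule S_eqI[OF B10_scale[OF S]]) (simp only: P_scale T_scale[OF S] TS)
  have norm_S: "B10_norm (S x) \<le> J' / c * norm x" for x
  proof -
    have "c * B10_norm (S x) \<le> J' * norm x" using low[OF S, of x] J'[of x] by (simp add: TS)
    then show ?thesis using c by (simp add: pos_le_divide_eq mult.commute)
  qed
  have S_T: "S (T u) = u" if "u \<in> B10_carrier" for u
    using that by (rule S_eqI) (rule PT[OF that])
  have P_comp: "P (x - P x + T u) = T u" if "u \<in> B10_carrier" for x u
    by (simp add: P_add P_diff PP PT[OF that])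
  have S_comp: "S (x - P x + T u) = u" if "u \<in> B10_carrier" for x u
    using that by (rule S_eqI) (rule P_comp[OF that])
  define \<Phi> where "\<Phi> x = x - P x + T (hotel_shift (S x))" for x
  define \<Psi> where "\<Psi> x = x - P x + T (hotel_unshift (S x))" for x
  define \<Theta> where "\<Theta> u = T (hotel_in u)" for u
  define R where "R x = hotel_out (S x)" for x
  \<comment> \<open>A sum of nonnegative terms that dominates the bounds of all four maps at once;
    the factors 2 are those of the hotel maps.\<close>
  define K where "K = 1 + J' + L' * (2 * (J' / c)) + L' * 2 + 2 * (J' / c)"
  have pos: "0 \<le> J' / c" "0 \<le> L' * (2 * (J' / c))" using J0 L0 c by simp_all
  have bound: "norm (x - P x + T u) \<le> K * norm x"
    if "u \<in> B10_carrier" "B10_norm u \<le> 2 * B10_norm (S x)" for x u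
  proof -
    have "norm (T u) \<le> L' * (2 * (J' / c * norm x))"
      using upp'[OF that(1)] that(2) norm_S[of x] L0
      by (elim order_trans) (intro mult_left_mono, simp_all)
    then have "norm (x - P x + T u) \<le> (norm x + J' * norm x) + L' * (2 * (J' / c * norm x))"
      using J'[of x] by (intro norm_triangle_mono order_trans[OF norm_triangle_ineq4 add_left_mono])
    also have "\<dots> = (1 + J' + L' * (2 * (J' / c))) * norm x" by (simp add: algebra_simps)
    also have "\<dots> \<le> K * norm x"
      using pos L0 unfolding K_def by (intro mult_right_mono) simp_all
    finally show ?thesis .
  qed
  have "B10_summand smul \<Phi> \<Psi> \<Theta> R K"
  proof (intro B10_summand.intro B10_summand_axioms.intro)
    show "banach_over smul" by (rule banach_over_axioms)
    show "0 < K" using pos J0 L0 unfolding K_def by linarith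
    fix x y a
    show "\<Phi> (x + y) = \<Phi> x + \<Phi> y"
      unfolding \<Phi>_def S_add hotel_add T_add[OF hotel_shift_carrier(1)[OF S] hotel_shift_carrier(1)[OF S]] P_add
      by simp
    show "\<Phi> (smul a x) = smul a (\<Phi> x)"
      unfolding \<Phi>_def S_scale hotel_scale T_scale[OF hotel_shift_carrier(1)[OF S]] P_scale
      by (simp only: scale_right_distrib scale_right_diff_distrib)
    show "norm (\<Phi> x) \<le> K * norm x"
      unfolding \<Phi>_def by (rule bound[OF hotel_shift_carrier[OF S]])
    show "\<Psi> (x + y) = \<Psi> x + \<Psi> y"
      unfolding \<Psi>_def S_add hotel_add T_add[OF hotel_unshift_carrier(1)[OF S] hotel_unshift_carrier(1)[OF S]] P_add
      by simp
    show "\<Psi> (smul a x) = smul a (\<Psi> x)"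
      unfolding \<Psi>_def S_scale hotel_scale T_scale[OF hotel_unshift_carrier(1)[OF S]] P_scale
      by (simp only: scale_right_distrib scale_right_diff_distrib)
    show "norm (\<Psi> x) \<le> K * norm x"
      unfolding \<Psi>_def by (rule bound[OF hotel_unshift_carrier[OF S]])
    show "R x \<in> B10_carrier" unfolding R_def by (rule hotel_out_carrier(1)[OF S])
    show "R (x + y) = (\<lambda>n i. R x n i + R y n i)" unfolding R_def S_add hotel_add ..
    show "R (smul a x) = (\<lambda>n i. a * R x n i)" unfolding R_def S_scale hotel_scale ..
    have "B10_norm (R x) \<le> 2 * B10_norm (S x)" unfolding R_def by (rule hotel_out_carrier(2)[OF S])
    also have "\<dots> \<le> 2 * (J' / c) * norm x" using norm_S[of x] by simp
    also have "\<dots> \<le> K * norm x"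
      using pos J0 L0 unfolding K_def by (intro mult_right_mono) simp_all
    finally show "B10_norm (R x) \<le> K * norm x" .
    show "\<Psi> (\<Phi> x) = x"
    proof -
      have "P (\<Phi> x) = T (hotel_shift (S x))" "S (\<Phi> x) = hotel_shift (S x)"
        unfolding \<Phi>_def by (rule P_comp S_comp, rule hotel_shift_carrier(1)[OF S])+
      then show ?thesis unfolding \<Psi>_def by (simp add: hotel_unshift_shift TS) (simp add: \<Phi>_def)
    qed
    show "R (\<Phi> x) = (\<lambda>n i. 0)"
      unfolding R_def \<Phi>_def S_comp[OF hotel_shift_carrier(1)[OF S]] by (rule hotel_out_shift)
    show "\<Phi> (\<Psi> x) + \<Theta> (R x) = x"
    proof -
      have p: "P (\<Psi> x) = T (hotel_unshift (S x))" and s: "S (\<Psi> x) = hotel_unshift (S x)"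
        unfolding \<Psi>_def by (rule P_comp S_comp, rule hotel_unshift_carrier(1)[OF S])+
      have "T (hotel_shift (hotel_unshift (S x))) + T (hotel_in (hotel_out (S x)))
        = T (\<lambda>n i. hotel_shift (hotel_unshift (S x)) n i + hotel_in (hotel_out (S x)) n i)"
        by (intro T_add[symmetric] hotel_shift_carrier hotel_unshift_carrier hotel_in_carrier hotel_out_carrier S)
      also have "\<dots> = P x" unfolding hotel_decomposition by (simp only: TS)
      finally have "T (hotel_shift (hotel_unshift (S x))) + T (hotel_in (hotel_out (S x))) = P x" .
      moreover have "\<Psi> x - P (\<Psi> x) = x - P x" unfolding p by (simp add: \<Psi>_def)
      ultimately show ?thesis unfolding \<Phi>_def s \<Theta>_def R_def by (simp add: add.assoc)
    qed
  next
    fix u v :: "nat \<Rightarrow> nat \<Rightarrow> 'f" and a assume u: "u \<in> B10_carrier"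
    note iu = hotel_in_carrier[OF u]
    show "\<Theta> (\<lambda>n i. a * u n i) = smul a (\<Theta> u)"
      unfolding \<Theta>_def hotel_scale by (rule T_scale[OF iu(1)])
    have "norm (\<Theta> u) \<le> L' * (2 * B10_norm u)"
      unfolding \<Theta>_def using iu(2) L0 by (intro order_trans[OF upp'[OF iu(1)]] mult_left_mono)
    also have "\<dots> = (L' * 2) * B10_norm u" by simp
    also have "\<dots> \<le> K * B10_norm u"
      using pos J0 B10_norm_nonneg[OF u] unfolding K_def by (intro mult_right_mono) simp_all
    finally show "norm (\<Theta> u) \<le> K * B10_norm u" .
    show "\<Psi> (\<Theta> u) = 0"
      unfolding \<Psi>_def \<Theta>_def PT[OF iu(1)] S_T[OF iu(1)] hotel_unshift_in T0 by simp
    show "R (\<Theta> u) = u"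
      unfolding R_def \<Theta>_def S_T[OF iu(1)] by (rule hotel_out_in[OF u])
    assume v: "v \<in> B10_carrier"
    show "\<Theta> (\<lambda>n i. u n i + v n i) = \<Theta> u + \<Theta> v"
      unfolding \<Theta>_def hotel_add by (rule T_add[OF iu(1) hotel_in_carrier(1)[OF v]])
  qed
  then show ?thesis by blast
qed

theorem theorem3p2:
  fixes smul :: "'f::{real_normed_field,euclidean_space} \<Rightarrow> 'x::banach \<Rightarrow> 'x"
    and B\<^sub>0 :: "nat \<Rightarrow> 'x"
  assumes "banach_over smul"
    and "quasi_greedy_basis smul B\<^sub>0"
    and "\<exists>Y. complemented_subspace smul Y \<and> B10_isomorphic_to smul Y"
  shows "\<exists>B :: nat \<Rightarrow> 'x. quasi_greedy_basis smul B \<and>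
           approx_on {2..} (L_const smul B) (\<lambda>m. ln (real m))"
proof -
  obtain Y where "complemented_subspace smul Y" "B10_isomorphic_to smul Y" using assms(3) by blast
  then obtain \<Phi> \<Psi> \<Theta> R K where "B10_summand smul \<Phi> \<Psi> \<Theta> R K"
    using banach_over.ex_B10_summand[OF assms(1)] by blast
  then interpret B10_summand smul \<Phi> \<Psi> \<Theta> R K .
  show ?thesis using interleave_quasi_greedy[OF assms(2)] interleave_L_const[OF assms(2)] by blast
qed

end
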